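(* Let $\boldsymbol{a}=(a_1,\ldots,a_n)\in\mathbb{Z}^n$ with $a_1<0$ and $a_i>0$ for all $i>1$. If $a_1$ divides $\sum_{j=2}^na_j$, then the invariant ring $\mathbb{C}[\mathbb{C}^n]^{\mathbb{C}^\times_{\boldsymbol{a}}}$ is Gorenstein, with $a$-invariant $$\frac{\sum_{j=1}^na_j}{a_1}-n.$$
   Context: $\mathbb{C}^\times$ acts on $\mathbb{C}^n$ with weight vector $\boldsymbol{a}$ by $w\cdot(z_1,\ldots,z_n)=(w^{a_1}z_1,\ldots,w^{a_n}z_n)$, and $\mathbb{C}[\mathbb{C}^n]^{\mathbb{C}^\times_{\boldsymbol{a}}}$ is the algebra of invariant polynomials, graded by polynomial degree. The $a$-invariant of such a graded algebra $R$ is the degree (degree of numerator minus degree of denominator) of its Hilbert series $\sum_{d\geq0}\dim_{\mathbb{C}}(R_d)t^d$ as a rational function of $t$. *)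

theory Defs
  imports
    Complex_Main
    "HOL-Library.Poly_Mapping"
    "HOL-Computational_Algebra.Polynomial_FPS"
    "HOL-Algebra.QuotRing"
    "HOL-Algebra.Ring_Divisibility"
begin

section \<open>Gorenstein rings\<close>

text \<open>The fraction \<open>r/s\<close> in the localization of a commutative ring \<open>R\<close> at a prime
  ideal \<open>P\<close>, as the equivalence class of the pair \<open>(r, s)\<close>.\<close>

definition loc_frac :: "('a, 'm) ring_scheme \<Rightarrow> 'a set \<Rightarrow> 'a \<Rightarrow> 'a \<Rightarrow> ('a \<times> 'a) set" where
  "loc_frac R P r s =
     {(r', s'). r' \<in> carrier R \<and> s' \<in> carrier R - P \<and>
        (\<exists>u \<in> carrier R - P. u \<otimes>\<^bsub>R\<^esub> (r \<otimes>\<^bsub>R\<^esub> s' \<ominus>\<^bsub>R\<^esub> r' \<otimes>\<^bsub>R\<^esub> s) = \<zero>\<^bsub>R\<^esub>)}"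

definition localization :: "('a, 'm) ring_scheme \<Rightarrow> 'a set \<Rightarrow> ('a \<times> 'a) set ring" where
  "localization R P =
     \<lparr> carrier = {loc_frac R P r s | r s. r \<in> carrier R \<and> s \<in> carrier R - P},
       mult = (\<lambda>X Y. \<Union>(r, s) \<in> X. \<Union>(r', s') \<in> Y. loc_frac R P (r \<otimes>\<^bsub>R\<^esub> r') (s \<otimes>\<^bsub>R\<^esub> s')),
       one = loc_frac R P \<one>\<^bsub>R\<^esub> \<one>\<^bsub>R\<^esub>,
       zero = loc_frac R P \<zero>\<^bsub>R\<^esub> \<one>\<^bsub>R\<^esub>,
       add = (\<lambda>X Y. \<Union>(r, s) \<in> X. \<Union>(r', s') \<in> Y.
                loc_frac R P (r \<otimes>\<^bsub>R\<^esub> s' \<oplus>\<^bsub>R\<^esub> r' \<otimes>\<^bsub>R\<^esub> s) (s \<otimes>\<^bsub>R\<^esub> s')) \<rparr>"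

definition noetherian_local_ring :: "('a, 'm) ring_scheme \<Rightarrow> 'a set \<Rightarrow> bool" where
  "noetherian_local_ring A \<mm> \<longleftrightarrow>
     cring A \<and> noetherian_ring A \<and> maximalideal \<mm> A \<and> (\<forall>J. maximalideal J A \<longrightarrow> J = \<mm>)"

text \<open>For a sequence in the maximal ideal, the quotient by the ideal it generates is
  automatically nonzero.\<close>

definition regular_sequence :: "('a, 'm) ring_scheme \<Rightarrow> 'a set \<Rightarrow> 'a list \<Rightarrow> bool" where
  "regular_sequence A \<mm> xs \<longleftrightarrow>
     set xs \<subseteq> \<mm> \<and>
     (\<forall>i < length xs. \<forall>r \<in> carrier A.
        (xs ! i) \<otimes>\<^bsub>A\<^esub> r \<in> Idl\<^bsub>A\<^esub> (set (take i xs)) \<longrightarrow> r \<in> Idl\<^bsub>A\<^esub> (set (take i xs)))"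

text \<open>In a Noetherian local ring, \<open>I \<subseteq> \<mm>\<close> is \<open>\<mm>\<close>-primary iff its radical is \<open>\<mm>\<close>.\<close>

definition max_primary :: "('a, 'm) ring_scheme \<Rightarrow> 'a set \<Rightarrow> 'a set \<Rightarrow> bool" where
  "max_primary A \<mm> I \<longleftrightarrow>
     ideal I A \<and> I \<subseteq> \<mm> \<and> (\<forall>r \<in> \<mm>. \<exists>k::nat. r [^]\<^bsub>A\<^esub> k \<in> I)"

text \<open>The socle of \<open>A/I\<close> is \<open>(I : \<mm>)/I\<close>, a vector space over the residue field \<open>A/\<mm>\<close>. It has
  dimension 1 iff it is spanned by the class of a single \<open>s \<notin> I\<close>.\<close>

definition colon_max :: "('a, 'm) ring_scheme \<Rightarrow> 'a set \<Rightarrow> 'a set \<Rightarrow> 'a set" where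
  "colon_max A \<mm> I = {r \<in> carrier A. \<forall>y \<in> \<mm>. y \<otimes>\<^bsub>A\<^esub> r \<in> I}"

definition simple_socle :: "('a, 'm) ring_scheme \<Rightarrow> 'a set \<Rightarrow> 'a set \<Rightarrow> bool" where
  "simple_socle A \<mm> I \<longleftrightarrow>
     (\<exists>s \<in> colon_max A \<mm> I - I. \<forall>t \<in> colon_max A \<mm> I. \<exists>c \<in> carrier A. t \<ominus>\<^bsub>A\<^esub> c \<otimes>\<^bsub>A\<^esub> s \<in> I)"

text \<open>A Noetherian local ring is Gorenstein if it is Cohen-Macaulay of type 1: some system of
  parameters \<open>x\<^sub>1, \<dots>, x\<^sub>d\<close> is a regular sequence and \<open>A/(x\<^sub>1, \<dots>, x\<^sub>d)\<close> has a one-dimensional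
  socle. The length of a regular sequence generating an \<open>\<mm>\<close>-primary ideal is necessarily the
  Krull dimension of \<open>A\<close>, so such a sequence is a system of parameters; and the dimension of the
  socle (the type of \<open>A\<close>) does not depend on the choice of the sequence.\<close>

definition gorenstein_local_ring :: "('a, 'm) ring_scheme \<Rightarrow> bool" where
  "gorenstein_local_ring A \<longleftrightarrow>
     (\<exists>\<mm>. noetherian_local_ring A \<mm> \<and>
        (\<exists>xs. regular_sequence A \<mm> xs \<and>
              max_primary A \<mm> (Idl\<^bsub>A\<^esub> (set xs)) \<and>
              simple_socle A \<mm> (Idl\<^bsub>A\<^esub> (set xs))))"

definition gorenstein_ring :: "('a, 'm) ring_scheme \<Rightarrow> bool" where
  "gorenstein_ring R \<longleftrightarrow>
     cring R \<and> noetherian_ring R \<and>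
     (\<forall>P. maximalideal P R \<longrightarrow> gorenstein_local_ring (localization R P))"


section \<open>Polynomials and invariants\<close>

text \<open>A monomial is a finitely supported exponent vector, and a polynomial is a finitely supported
  family of coefficients; the type class multiplication on \<open>mpoly_c\<close> is convolution, i.e.
  multiplication of polynomials. The variables are indexed by \<open>nat\<close>, of which \<open>\<complex>[\<complex>\<^sup>n]\<close> uses
  \<open>1, \<dots>, n\<close>.\<close>

type_synonym mpoly_c = "(nat \<Rightarrow>\<^sub>0 nat) \<Rightarrow>\<^sub>0 complex"

definition polys_in :: "nat \<Rightarrow> mpoly_c set" where
  "polys_in n = {p. \<forall>m \<in> Poly_Mapping.keys p. Poly_Mapping.keys m \<subseteq> {1..n}}"

definition eval_poly :: "mpoly_c \<Rightarrow> (nat \<Rightarrow> complex) \<Rightarrow> complex" where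
  "eval_poly p z =
     (\<Sum>m \<in> Poly_Mapping.keys p.
        Poly_Mapping.lookup p m * (\<Prod>i \<in> Poly_Mapping.keys m. z i ^ Poly_Mapping.lookup m i))"

text \<open>Points of \<open>\<complex>\<^sup>n\<close> are represented by functions on \<open>nat\<close>; coordinates outside \<open>1, \<dots>, n\<close> have
  no influence on the value of a polynomial in \<open>polys_in n\<close>.\<close>

definition circle_act :: "(nat \<Rightarrow> int) \<Rightarrow> complex \<Rightarrow> (nat \<Rightarrow> complex) \<Rightarrow> (nat \<Rightarrow> complex)" where
  "circle_act a w z = (\<lambda>i. w powi (a i) * z i)"

definition invariant_polys :: "nat \<Rightarrow> (nat \<Rightarrow> int) \<Rightarrow> mpoly_c set" where
  "invariant_polys n a =
     {p \<in> polys_in n. \<forall>w z. w \<noteq> 0 \<longrightarrow> eval_poly p (circle_act a w z) = eval_poly p z}"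

definition invariant_ring :: "nat \<Rightarrow> (nat \<Rightarrow> int) \<Rightarrow> mpoly_c ring" where
  "invariant_ring n a =
     \<lparr> carrier = invariant_polys n a, mult = (*), one = 1, zero = 0, add = (+) \<rparr>"


section \<open>Hilbert series and the a-invariant\<close>

definition monom_degree :: "(nat \<Rightarrow>\<^sub>0 nat) \<Rightarrow> nat" where
  "monom_degree m = (\<Sum>i \<in> Poly_Mapping.keys m. Poly_Mapping.lookup m i)"

definition homogeneous_part :: "mpoly_c set \<Rightarrow> nat \<Rightarrow> mpoly_c set" where
  "homogeneous_part V d = {p \<in> V. \<forall>m \<in> Poly_Mapping.keys p. monom_degree m = d}"

definition scale_poly :: "complex \<Rightarrow> mpoly_c \<Rightarrow> mpoly_c" where
  "scale_poly c p = Poly_Mapping.single 0 c * p"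

lemma vector_space_scale_poly: "vector_space scale_poly"
  by unfold_locales
    (simp_all add: scale_poly_def algebra_simps single_add mult_single
      flip: mult.assoc single_one)

definition hilbert_series :: "mpoly_c set \<Rightarrow> rat fps" where
  "hilbert_series V = Abs_fps (\<lambda>d. of_nat (vector_space.dim scale_poly (homogeneous_part V d)))"

text \<open>\<open>H\<close> is the expansion of a nonzero rational function \<open>p/q\<close> of degree \<open>k\<close>. Since the degree of
  a nonzero rational function does not depend on the chosen representation, there is at most one
  such \<open>k\<close>.\<close>

definition has_rational_degree :: "rat fps \<Rightarrow> int \<Rightarrow> bool" where
  "has_rational_degree H k \<longleftrightarrow>
     (\<exists>p q :: rat poly. p \<noteq> 0 \<and> q \<noteq> 0 \<and> fps_of_poly q * H = fps_of_poly p \<and>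
        k = int (Polynomial.degree p) - int (Polynomial.degree q))"

definition has_a_invariant :: "mpoly_c set \<Rightarrow> int \<Rightarrow> bool" where
  "has_a_invariant V k \<longleftrightarrow> has_rational_degree (hilbert_series V) k"

end

theory Submission
  imports
    Defs
    "HOL-Analysis.Continuum_Not_Denumerable"
    "HOL-Computational_Algebra.Fundamental_Theorem_Algebra"
begin

text \<open>Put \<open>k = - a 1\<close> and \<open>b i = a i\<close> for \<open>i \<ge> 2\<close>. The invariants are spanned by the monomials
  with \<open>k m\<^sub>1 = \<Sum> b\<^sub>i m\<^sub>i\<close>, so \<open>m\<^sub>1\<close> is determined by the other exponents. The invariant ring is free over the
  polynomial ring in the \<open>y\<^sub>i = x\<^sub>1^b\<^sub>i x\<^sub>i^k\<close>, with basis the invariant monomials whose exponents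
  \<open>m\<^sub>i\<close>, \<open>i \<ge> 2\<close>, are below \<open>k\<close>. By the Nullstellensatz a maximal ideal contains
  \<open>y\<^sub>i - c\<^sub>i\<close> for suitable constants \<open>c\<^sub>i\<close>; these form a regular sequence, and reading off the coefficient
  of the monomial with all \<open>m\<^sub>i = k - 1\<close> makes the quotient by them a Frobenius algebra, whose local
  factors have simple socles. That monomial is invariant exactly because \<open>k\<close> divides \<open>\<Sum> b\<^sub>i\<close>. The same
  basis gives the Hilbert series \<open>(\<Sum>\<^sub>e t^deg e) / \<Prod> (1 - t^(k + b\<^sub>i))\<close>, whose numerator has the degree of
  that monomial.\<close>

section \<open>Subrings and Hilbert's basis theorem\<close>

text \<open>The definition \<open>gorenstein_ring\<close> tests every maximal ideal, so an argument
  at the homogeneous one, where all \<open>c\<^sub>i\<close> vanish, does not suffice. For general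
  \<open>c\<close> the quotient by the parameters may have several maximal ideals, and then its
  socle need not be one-dimensional. What survives is the nondegenerate trace form, which is used
  separately at each point. It is nondegenerate for all \<open>c\<close> at once: an exponent vector
  \<open>e\<close> and its complement \<open>k - 1 - e\<close> add up without a carry, and the
  constants \<open>c\<^sub>i\<close> enter a product of basis monomials only through carries modulo
  \<open>k\<close>.

  The quotient by the parameters is never formed as a ring. Globally it is represented by a linear
  projection \<open>nf\<close> whose kernel is the ideal \<open>I\<close> of the parameters;
  locally, vanishing of \<open>x\<close> at \<open>P\<close> is expressed as
  \<open>u * x \<in> I\<close> for some \<open>u\<close> outside \<open>P\<close>. Regularity,
  finiteness and duality thus become statements about exponents modulo \<open>k\<close>.\<close>

definition ring_on :: "'a::comm_ring_1 set \<Rightarrow> 'a ring" where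
  "ring_on A = \<lparr>carrier = A, mult = (*), one = 1, zero = 0, add = (+)\<rparr>"

lemma ring_on_simps [simp]:
  "carrier (ring_on A) = A" "mult (ring_on A) = (*)" "one (ring_on A) = 1"
  "zero (ring_on A) = 0" "add (ring_on A) = (+)"
  by (simp_all add: ring_on_def)

text \<open>Arithmetic takes place in the ambient type, where the simplifier works, and only
  membership in \<open>A\<close> has to be tracked. The record \<open>ring_on A\<close> serves to
  speak about ideals and localizations.\<close>

locale comm_subring =
  fixes A :: "'a::comm_ring_1 set"
  assumes one_closed [simp]: "1 \<in> A"
    and add_closed [simp]: "x \<in> A \<Longrightarrow> y \<in> A \<Longrightarrow> x + y \<in> A"
    and mult_closed [simp]: "x \<in> A \<Longrightarrow> y \<in> A \<Longrightarrow> x * y \<in> A"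
    and uminus_closed [simp]: "x \<in> A \<Longrightarrow> - x \<in> A"
begin

lemma diff_closed [simp]: "x \<in> A \<Longrightarrow> y \<in> A \<Longrightarrow> x - y \<in> A"
  using add_closed[of x "- y"] by simp

lemma zero_closed [simp]: "0 \<in> A"
  using diff_closed[of 1 1] by simp

lemma sum_closed: "(\<And>i. i \<in> S \<Longrightarrow> f i \<in> A) \<Longrightarrow> sum f S \<in> A"
  by (induction S rule: infinite_finite_induct) auto

lemma prod_closed: "(\<And>i. i \<in> S \<Longrightarrow> f i \<in> A) \<Longrightarrow> prod f S \<in> A"
  by (induction S rule: infinite_finite_induct) auto

lemma power_closed [simp]: "x \<in> A \<Longrightarrow> x ^ k \<in> A"
  by (induction k) auto

lemma cring: "cring (ring_on A)"
proof (intro cringI abelian_groupI comm_monoidI)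
  fix x assume "x \<in> carrier (ring_on A)"
  then show "\<exists>y\<in>carrier (ring_on A). y \<oplus>\<^bsub>ring_on A\<^esub> x = \<zero>\<^bsub>ring_on A\<^esub>"
    by (auto intro!: bexI[of _ "- x"])
qed (auto simp: algebra_simps)

sublocale R: cring "ring_on A"
  by (rule cring)

lemma minus_eq [simp]:
  assumes "x \<in> A" "y \<in> A"
  shows "x \<ominus>\<^bsub>ring_on A\<^esub> y = x - y"
proof -
  have "\<ominus>\<^bsub>ring_on A\<^esub> y = - y"
    by (rule R.minus_equality) (use assms in auto)
  then show ?thesis
    by (simp add: a_minus_def)
qed

text \<open>Negatives come from multiplication by \<open>-1\<close>, which lies in \<open>A\<close>,
  so closure under addition and under multiplication by \<open>A\<close> already gives an additive
  subgroup.\<close>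

lemma ideal_iff:
  "ideal I (ring_on A) \<longleftrightarrow>
     I \<subseteq> A \<and> 0 \<in> I \<and> (\<forall>x\<in>I. \<forall>y\<in>I. x + y \<in> I) \<and> (\<forall>r\<in>A. \<forall>x\<in>I. r * x \<in> I)"
proof safe
  assume I: "ideal I (ring_on A)"
  interpret ideal I "ring_on A" by (rule I)
  show "\<And>x. x \<in> I \<Longrightarrow> x \<in> A" using a_subset by auto
  show "0 \<in> I" using additive_subgroup.zero_closed[OF is_additive_subgroup] by simp
  show "\<And>x y. x \<in> I \<Longrightarrow> y \<in> I \<Longrightarrow> x + y \<in> I" using a_closed by simp
  show "\<And>r x. r \<in> A \<Longrightarrow> x \<in> I \<Longrightarrow> r * x \<in> I" using I_l_closed by simp
next
  assume I: "I \<subseteq> A" "0 \<in> I" "\<forall>x\<in>I. \<forall>y\<in>I. x + y \<in> I" "\<forall>r\<in>A. \<forall>x\<in>I. r * x \<in> I"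
  have neg: "- x \<in> I" if "x \<in> I" for x
    using I(4)[rule_format, of "-1" x] that by simp
  have "subgroup I (add_monoid (ring_on A))"
  proof (rule R.add.subgroupI)
    fix x assume x: "x \<in> I"
    have "\<ominus>\<^bsub>ring_on A\<^esub> x = - x"
      by (rule R.minus_equality) (use x I in auto)
    then show "\<ominus>\<^bsub>ring_on A\<^esub> x \<in> I" using neg x by simp
  qed (use I in auto)
  moreover have "\<forall>x\<in>I. \<forall>r\<in>A. x * r \<in> I"
    using I(4) by (metis mult.commute)
  ultimately show "ideal I (ring_on A)"
    by (intro idealI R.ring_axioms) (use I(4) in auto)
qed

lemma idealD:
  assumes "ideal I (ring_on A)"
  shows "I \<subseteq> A" "0 \<in> I" "x \<in> I \<Longrightarrow> y \<in> I \<Longrightarrow> x + y \<in> I" "r \<in> A \<Longrightarrow> x \<in> I \<Longrightarrow> r * x \<in> I"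
    "x \<in> I \<Longrightarrow> y \<in> I \<Longrightarrow> x - y \<in> I"
proof -
  have *: "I \<subseteq> A" "0 \<in> I" "\<forall>x\<in>I. \<forall>y\<in>I. x + y \<in> I" "\<forall>r\<in>A. \<forall>x\<in>I. r * x \<in> I"
    using assms by (simp_all add: ideal_iff)
  show "I \<subseteq> A" "0 \<in> I"
    by (fact *)+
  show "x \<in> I \<Longrightarrow> y \<in> I \<Longrightarrow> x + y \<in> I"
    using *(3) by blast
  show "r \<in> A \<Longrightarrow> x \<in> I \<Longrightarrow> r * x \<in> I"
    using *(4) by blast
  show "x - y \<in> I" if "x \<in> I" "y \<in> I"
  proof -
    have "-1 * y \<in> I" using *(4) that(2) one_closed uminus_closed by blast
    then have "x + -1 * y \<in> I" using *(3) that(1) by blast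
    then show ?thesis by simp
  qed
qed

lemma ideal_sum: "ideal I (ring_on A) \<Longrightarrow> (\<And>i. i \<in> S \<Longrightarrow> f i \<in> I) \<Longrightarrow> sum f S \<in> I"
  by (induction S rule: infinite_finite_induct) (auto intro: idealD)

lemma gen_ideal: "X \<subseteq> A \<Longrightarrow> ideal (Idl\<^bsub>ring_on A\<^esub> X) (ring_on A)"
  using R.genideal_ideal by simp

lemma gen_incl: "X \<subseteq> A \<Longrightarrow> X \<subseteq> Idl\<^bsub>ring_on A\<^esub> X"
  using R.genideal_self by simp

lemma gen_least: "ideal I (ring_on A) \<Longrightarrow> X \<subseteq> I \<Longrightarrow> Idl\<^bsub>ring_on A\<^esub> X \<subseteq> I"
  using R.genideal_minimal by simp

section \<open>Adjoining one element\<close>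

definition coeffs_in :: "'a poly \<Rightarrow> bool" where
  "coeffs_in p \<longleftrightarrow> (\<forall>i. Polynomial.coeff p i \<in> A)"

lemma coeffs_inD [simp]: "coeffs_in p \<Longrightarrow> Polynomial.coeff p i \<in> A"
  by (simp add: coeffs_in_def)

definition adjoin :: "'a \<Rightarrow> 'a set" where
  "adjoin y = {poly p y | p. coeffs_in p}"

lemma coeffs_in_intros:
  "coeffs_in p \<Longrightarrow> coeffs_in q \<Longrightarrow> coeffs_in (p + q)"
  "coeffs_in p \<Longrightarrow> coeffs_in q \<Longrightarrow> coeffs_in (p - q)"
  "coeffs_in p \<Longrightarrow> coeffs_in q \<Longrightarrow> coeffs_in (p * q)"
  "coeffs_in p \<Longrightarrow> coeffs_in (- p)"
  "c \<in> A \<Longrightarrow> coeffs_in (Polynomial.monom c k)"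
  "c \<in> A \<Longrightarrow> coeffs_in p \<Longrightarrow> coeffs_in (pCons c p)"
  "coeffs_in 0" "coeffs_in 1"
  "c \<in> A \<Longrightarrow> coeffs_in p \<Longrightarrow> coeffs_in (Polynomial.smult c p)"
  by (auto simp: coeffs_in_def coeff_mult coeff_pCons intro!: sum_closed split: nat.splits)

lemma adjoin_subring: "comm_subring (adjoin y)"
proof
  show "1 \<in> adjoin y"
    unfolding adjoin_def using coeffs_in_intros(8) by (intro CollectI exI[of _ 1]) simp
  fix u v assume "u \<in> adjoin y" "v \<in> adjoin y"
  then obtain p q where p: "u = poly p y" "coeffs_in p" and q: "v = poly q y" "coeffs_in q"
    unfolding adjoin_def by blast
  show "u + v \<in> adjoin y"
    unfolding adjoin_def using p q coeffs_in_intros(1)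
    by (intro CollectI exI[of _ "p + q"]) simp
  show "u * v \<in> adjoin y"
    unfolding adjoin_def using p q coeffs_in_intros(3)
    by (intro CollectI exI[of _ "p * q"]) simp
next
  fix u assume "u \<in> adjoin y"
  then obtain p where p: "u = poly p y" "coeffs_in p"
    unfolding adjoin_def by blast
  show "- u \<in> adjoin y"
    unfolding adjoin_def using p coeffs_in_intros(4)
    by (intro CollectI exI[of _ "- p"]) simp
qed

lemma subset_adjoin: "A \<subseteq> adjoin y"
proof
  fix x assume "x \<in> A"
  then show "x \<in> adjoin y"
    unfolding adjoin_def by (intro CollectI exI[of _ "[:x:]"]) (auto intro!: coeffs_in_intros)
qed

lemma in_adjoin: "y \<in> adjoin y"
  unfolding adjoin_def
  by (intro CollectI exI[of _ "[:0, 1:]"]) (auto intro!: coeffs_in_intros)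

lemma adjoin_subset:
  assumes "comm_subring B" "A \<subseteq> B" "y \<in> B"
  shows "adjoin y \<subseteq> B"
proof -
  interpret B: comm_subring B by fact
  show ?thesis
    unfolding adjoin_def poly_altdef using assms by (auto intro!: B.sum_closed B.mult_closed)
qed

text \<open>Hilbert's basis theorem, with \<open>y\<close> not assumed to be transcendental over \<open>A\<close>.\<close>

theorem noetherian_adjoin:
  assumes "noetherian_ring (ring_on A)"
  shows "noetherian_ring (ring_on (adjoin y))"
proof -
  interpret B: comm_subring "adjoin y" by (rule adjoin_subring)
  let ?B = "ring_on (adjoin y)"
  have in_B: "poly p y \<in> adjoin y" if "coeffs_in p" for p
    using that unfolding adjoin_def by blast
  \<comment> \<open>The ideal of coefficients in degree \<open>d\<close> of polynomials representing
    elements of \<open>J\<close>. It is defined through polynomials because an element may have many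
    representations when \<open>y\<close> is algebraic; the bound \<open>\<le> d\<close> admits
    vanishing coefficients, which makes the set closed under addition.\<close>
  define Ld where "Ld J d = {Polynomial.coeff p d | p. coeffs_in p \<and> Polynomial.degree p \<le> d \<and> poly p y \<in> J}" for J d
  have Ld_ideal: "ideal (Ld J d) (ring_on A)" if J: "ideal J ?B" for J d
    unfolding ideal_iff
  proof safe
    fix x assume "x \<in> Ld J d" then show "x \<in> A" unfolding Ld_def by auto
  next
    show "0 \<in> Ld J d"
      unfolding Ld_def using coeffs_in_intros(7) B.idealD[OF J]
      by (intro CollectI exI[of _ 0]) auto
  next
    fix u v assume "u \<in> Ld J d" "v \<in> Ld J d"
    then obtain p q where p: "u = Polynomial.coeff p d" "coeffs_in p" "Polynomial.degree p \<le> d" "poly p y \<in> J"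
      and q: "v = Polynomial.coeff q d" "coeffs_in q" "Polynomial.degree q \<le> d" "poly q y \<in> J"
      unfolding Ld_def by blast
    show "u + v \<in> Ld J d"
      unfolding Ld_def using p q coeffs_in_intros(1) B.idealD[OF J]
      by (intro CollectI exI[of _ "p + q"]) (auto intro: degree_add_le)
  next
    fix r u assume r: "r \<in> A" and "u \<in> Ld J d"
    then obtain p where p: "u = Polynomial.coeff p d" "coeffs_in p" "Polynomial.degree p \<le> d" "poly p y \<in> J"
      unfolding Ld_def by blast
    have "r \<in> adjoin y" using r subset_adjoin by blast
    then show "r * u \<in> Ld J d"
      unfolding Ld_def using p r coeffs_in_intros(9)[of r p] B.idealD(4)[OF J]
      by (intro CollectI exI[of _ "Polynomial.smult r p"])
        (auto intro: order.trans[OF degree_smult_le])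
  qed
  have Ld_Suc: "Ld J d \<subseteq> Ld J (Suc d)" if J: "ideal J ?B" for J d
  proof
    fix u assume "u \<in> Ld J d"
    then obtain p where p: "u = Polynomial.coeff p d" "coeffs_in p" "Polynomial.degree p \<le> d" "poly p y \<in> J"
      unfolding Ld_def by blast
    show "u \<in> Ld J (Suc d)"
      unfolding Ld_def using p coeffs_in_intros(6)[OF zero_closed p(2)]
        B.idealD(4)[OF J in_adjoin p(4)]
      by (intro CollectI exI[of _ "pCons 0 p"]) (auto simp: degree_pCons_le intro: order.trans[OF degree_pCons_le])
  qed
  have Ld_mono: "Ld J d \<subseteq> Ld J e" if "ideal J ?B" "d \<le> e" for J d e
    using lift_Suc_mono_le[of "Ld J", OF Ld_Suc[OF that(1)] that(2)] .
  show ?thesis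
  proof (rule B.R.noetherian_ringI)
    fix J assume J: "ideal J ?B"
    have fg: "\<exists>G. finite G \<and> G \<subseteq> L \<and> L = Idl\<^bsub>ring_on A\<^esub> G" if L: "ideal L (ring_on A)" for L
    proof -
      obtain G where "G \<subseteq> A" "finite G" "L = Idl\<^bsub>ring_on A\<^esub> G"
        using noetherian_ring.finetely_gen[OF assms L] by (auto simp only: ring_on_simps)
      then show ?thesis using gen_incl by blast
    qed
    have "ideal (\<Union>d. Ld J d) (ring_on A)"
      unfolding ideal_iff
    proof safe
      fix x d assume "x \<in> Ld J d" then show "x \<in> A" using idealD(1)[OF Ld_ideal[OF J]] by blast
    next
      show "0 \<in> (\<Union>d. Ld J d)" using idealD(2)[OF Ld_ideal[OF J]] by blast
    next
      fix u v d e assume "u \<in> Ld J d" "v \<in> Ld J e"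
      then have "u \<in> Ld J (max d e)" "v \<in> Ld J (max d e)"
        using Ld_mono[OF J, of d "max d e"] Ld_mono[OF J, of e "max d e"] by auto
      then show "u + v \<in> (\<Union>d. Ld J d)" using idealD(3)[OF Ld_ideal[OF J]] by blast
    next
      fix r u d assume "r \<in> A" "u \<in> Ld J d"
      then show "r * u \<in> (\<Union>d. Ld J d)" using idealD(4)[OF Ld_ideal[OF J]] by blast
    qed
    then obtain G where G: "finite G" "G \<subseteq> (\<Union>d. Ld J d)" "(\<Union>d. Ld J d) = Idl\<^bsub>ring_on A\<^esub> G"
      using fg by meson
    have "\<exists>D. G \<subseteq> Ld J D"
      using G(1,2)
    proof (induction G)
      case (insert g G)
      then obtain D d where D: "G \<subseteq> Ld J D" "g \<in> Ld J d" by blast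
      then have "insert g G \<subseteq> Ld J (max d D)"
        using Ld_mono[OF J, of d "max d D"] Ld_mono[OF J, of D "max d D"] by auto
      then show ?case by blast
    qed auto
    then obtain D where D: "G \<subseteq> Ld J D" by blast
    obtain H where H: "\<And>d. finite (H d)" "\<And>d. H d \<subseteq> Ld J d" "\<And>d. Ld J d = Idl\<^bsub>ring_on A\<^esub> (H d)"
      using fg[OF Ld_ideal[OF J]] by metis
    \<comment> \<open>Generators tagged with the degree in which they are to be lifted. The
      ascending chain of the \<open>Ld J d\<close> has stopped growing at \<open>D\<close>, so
      \<open>G\<close> in degree \<open>D\<close> serves all higher degrees, and each degree up to
      \<open>D\<close> contributes its own finite set \<open>H d\<close>.\<close>
    define P where "P = (\<lambda>g. (g, D)) ` G \<union> (\<Union>d\<in>{..D}. (\<lambda>g. (g, d)) ` H d)"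
    have "finite P" unfolding P_def using G(1) H(1) by auto
    define good where "good g d p \<longleftrightarrow> coeffs_in p \<and> Polynomial.degree p \<le> d \<and>
      Polynomial.coeff p d = g \<and> poly p y \<in> J" for g d p
    define lift where "lift x = (SOME p. good (fst x) (snd x) p)" for x
    have lift: "good g d (lift (g, d))" if "(g, d) \<in> P" for g d
    proof -
      have "g \<in> Ld J d" using that D H(2) unfolding P_def by auto
      then have "\<exists>p. good g d p" unfolding Ld_def good_def by blast
      then show ?thesis unfolding lift_def by (simp add: someI_ex)
    qed
    define F where "F = (\<lambda>x. poly (lift x) y) ` P"
    have F: "finite F" "F \<subseteq> J" unfolding F_def using \<open>finite P\<close> lift by (auto simp: good_def)
    then have FB: "F \<subseteq> adjoin y" using B.idealD(1)[OF J] by blast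
    let ?K = "Idl\<^bsub>?B\<^esub> F"
    have K: "ideal ?K ?B" by (rule B.gen_ideal[OF FB])
    have P_Ld: "g \<in> Ld ?K d" if "(g, d) \<in> P" for g d
    proof -
      have "poly (lift (g, d)) y \<in> ?K" using B.gen_incl[OF FB] that unfolding F_def by blast
      then show ?thesis
        using lift[OF that] unfolding Ld_def good_def by (intro CollectI exI[of _ "lift (g, d)"]) auto
    qed
    have lead: "Ld J d \<subseteq> Ld ?K d" for d
    proof (cases "d \<le> D")
      case True
      then have "H d \<subseteq> Ld ?K d" using P_Ld unfolding P_def by blast
      then show ?thesis using gen_least[OF Ld_ideal[OF K]] H(3)[of d] by metis
    next
      case False
      have "G \<subseteq> Ld ?K D" using P_Ld unfolding P_def by blast
      also have "\<dots> \<subseteq> Ld ?K d" using False by (intro Ld_mono[OF K]) auto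
      finally have "(\<Union>d. Ld J d) \<subseteq> Ld ?K d" unfolding G(3) using gen_least[OF Ld_ideal[OF K]] by metis
      then show ?thesis by blast
    qed
    have KJ: "?K \<subseteq> J" using B.gen_least[OF J F(2)] .
    \<comment> \<open>Subtracting an element of \<open>?K\<close> with the same coefficient in the
      top degree lowers the degree. The strict bound makes the base case vacuous, and for
      \<open>d = 0\<close> the difference is already zero.\<close>
    have main: "Polynomial.degree p < d \<Longrightarrow> coeffs_in p \<Longrightarrow> poly p y \<in> J \<Longrightarrow> poly p y \<in> ?K" for p d
    proof (induction d arbitrary: p)
      case (Suc d)
      have "Polynomial.coeff p d \<in> Ld J d" using Suc.prems unfolding Ld_def by auto
      then obtain q where q: "Polynomial.coeff p d = Polynomial.coeff q d" "coeffs_in q" "Polynomial.degree q \<le> d" "poly q y \<in> ?K"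
        using lead unfolding Ld_def by blast
      have "poly (p - q) y \<in> ?K"
      proof (cases "p - q = 0")
        case True
        then show ?thesis using B.idealD(2)[OF K] by (simp only: poly_0)
      next
        case False
        have "Polynomial.degree (p - q) \<le> d" using Suc.prems(1) q(3) by (intro degree_diff_le) auto
        moreover have "Polynomial.degree (p - q) \<noteq> d"
        proof
          assume "Polynomial.degree (p - q) = d"
          then have "lead_coeff (p - q) = 0" using q(1) by simp
          then show False using False leading_coeff_0_iff by blast
        qed
        ultimately show ?thesis
        proof (cases "d = 0")
          case False
          show ?thesis
            using \<open>Polynomial.degree (p - q) \<le> d\<close> \<open>Polynomial.degree (p - q) \<noteq> d\<close> Suc.prems q(2,4) KJ
              coeffs_in_intros(2)[of p q] B.idealD(5)[OF J]
            by (intro Suc.IH) auto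
        qed auto
      qed
      then have "poly (p - q) y + poly q y \<in> ?K" using q(4) B.idealD(3)[OF K] by blast
      then show ?case by simp
    qed simp
    have "J \<subseteq> ?K"
    proof
      fix x assume x: "x \<in> J"
      then obtain p where "x = poly p y" "coeffs_in p"
        using B.idealD(1)[OF J] unfolding adjoin_def by blast
      then show "x \<in> ?K" using main[of p "Suc (Polynomial.degree p)"] x by simp
    qed
    then show "\<exists>X\<subseteq>carrier ?B. finite X \<and> J = Idl\<^bsub>?B\<^esub> X"
      using KJ F(1) FB by auto
  qed
qed

end

text \<open>The generators are adjoined one at a time, staying inside \<open>B\<close>. Finite
  generation is expressed by the minimality condition \<open>least\<close>, which identifies the
  last ring of the tower with \<open>B\<close>.\<close>

theorem noetherian_fin_gen:
  assumes K: "comm_subring K" "noetherian_ring (ring_on K)"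
    and "finite G" and B: "comm_subring B" "K \<subseteq> B" "G \<subseteq> B"
    and least: "\<And>C. comm_subring C \<Longrightarrow> K \<subseteq> C \<Longrightarrow> G \<subseteq> C \<Longrightarrow> B \<subseteq> C"
  shows "noetherian_ring (ring_on B)"
proof -
  have "\<exists>C. comm_subring C \<and> noetherian_ring (ring_on C) \<and> K \<subseteq> C \<and> G \<subseteq> C \<and> C \<subseteq> B"
    using \<open>finite G\<close> \<open>G \<subseteq> B\<close>
  proof (induction G)
    case empty
    then show ?case using K B by blast
  next
    case (insert g G)
    then obtain C where C: "comm_subring C" "noetherian_ring (ring_on C)" "K \<subseteq> C" "G \<subseteq> C" "C \<subseteq> B"
      by blast
    interpret comm_subring C by fact
    show ?case
      using C noetherian_adjoin[OF C(2), of g] adjoin_subring[of g] subset_adjoin[of g]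
        in_adjoin[of g] adjoin_subset[OF B(1) C(5), of g] insert.prems
      by (intro exI[of _ "adjoin g"]) blast
  qed
  then obtain C where "comm_subring C" "noetherian_ring (ring_on C)" "K \<subseteq> C" "G \<subseteq> C" "C \<subseteq> B"
    by blast
  then show ?thesis using least[of C] by auto
qed

section \<open>Localization at a prime\<close>

locale prime_of_subring = comm_subring A for A :: "'a::idom set" +
  fixes P :: "'a set"
  assumes P_ideal: "ideal P (ring_on A)"
    and one_notin_P: "1 \<notin> P"
    and P_prime: "x \<in> A \<Longrightarrow> y \<in> A \<Longrightarrow> x * y \<in> P \<Longrightarrow> x \<in> P \<or> y \<in> P"
begin

definition "S = A - P"

definition "qt r s = loc_frac (ring_on A) P r s"

definition "L = localization (ring_on A) P"

definition "ext I = {qt r s | r s. r \<in> I \<and> s \<in> S}"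

lemma S_closed: "1 \<in> S" "s \<in> S \<Longrightarrow> t \<in> S \<Longrightarrow> s * t \<in> S"
  using P_prime one_notin_P by (auto simp: S_def)

lemma S_D: "s \<in> S \<Longrightarrow> s \<in> A" "s \<in> S \<Longrightarrow> s \<noteq> 0"
  using idealD(2)[OF P_ideal] by (auto simp: S_def)

lemma S_prod: "finite F \<Longrightarrow> (\<And>i. i \<in> F \<Longrightarrow> f i \<in> S) \<Longrightarrow> prod f F \<in> S"
  by (induction F rule: finite_induct) (auto intro: S_closed)

text \<open>Elements of \<open>S\<close> are nonzero and the ambient ring is a domain, so the factor
  \<open>u\<close> in \<open>loc_frac\<close> cancels and only cross multiplication remains.\<close>

lemma qt_eq_set:
  assumes "r \<in> A" "s \<in> S"
  shows "qt r s = {(r', s'). r' \<in> A \<and> s' \<in> S \<and> r * s' = r' * s}"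
proof -
  have "(\<exists>u\<in>A - P. u * (r * s' - r' * s) = 0) \<longleftrightarrow> r * s' = r' * s" for r' s'
    using S_closed(1) S_D unfolding S_def[symmetric] by (auto intro!: bexI[of _ 1])
  then show ?thesis
    unfolding qt_def loc_frac_def using assms by (auto simp: S_def)
qed

lemma qt_self: "r \<in> A \<Longrightarrow> s \<in> S \<Longrightarrow> (r, s) \<in> qt r s"
  by (simp add: qt_eq_set)

text \<open>Transitivity of cross multiplication: both sides agree after multiplication by the
  nonzero \<open>s'\<close>.\<close>

lemma qt_cancel:
  fixes r s r' s' r'' s'' :: 'a
  assumes "s' \<noteq> 0" "r * s' = r' * s" "r' * s'' = r'' * s'"
  shows "r * s'' = r'' * s"
proof -
  have "s' * (r * s'') = (r * s') * s''" by (simp add: ac_simps)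
  also have "\<dots> = (r' * s'') * s" using assms by (simp add: ac_simps)
  also have "\<dots> = s' * (r'' * s)" using assms by (simp add: ac_simps)
  finally show ?thesis using assms(1) by simp
qed

lemma qt_eq_iff:
  assumes "r \<in> A" "s \<in> S" "r' \<in> A" "s' \<in> S"
  shows "qt r s = qt r' s' \<longleftrightarrow> r * s' = r' * s"
proof
  assume "qt r s = qt r' s'"
  then have "(r', s') \<in> qt r s" using qt_self assms by auto
  then show "r * s' = r' * s" using assms by (simp add: qt_eq_set)
next
  assume eq: "r * s' = r' * s"
  have "r * t' = t * s \<longleftrightarrow> r' * t' = t * s'" if "t' \<in> S" for t t'
    using qt_cancel[of s' r r' s t' t] qt_cancel[of s r' r s' t' t] eq assms S_D by metis
  then show "qt r s = qt r' s'"
    using assms by (auto simp: qt_eq_set)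
qed

lemma carrier_L: "carrier L = {qt r s | r s. r \<in> A \<and> s \<in> S}"
  by (simp add: L_def localization_def qt_def S_def)

lemma qt_closed: "r \<in> A \<Longrightarrow> s \<in> S \<Longrightarrow> qt r s \<in> carrier L"
  by (auto simp: carrier_L)

lemma one_L: "one L = qt 1 1" and zero_L: "zero L = qt 0 1"
  by (simp_all add: L_def localization_def qt_def)

text \<open>The product in the record is a union over all pairs of representatives. Every pair
  yields the same class and the classes are nonempty, so the union collapses to that class.\<close>

lemma mult_qt:
  assumes "r \<in> A" "s \<in> S" "r' \<in> A" "s' \<in> S"
  shows "qt r s \<otimes>\<^bsub>L\<^esub> qt r' s' = qt (r * r') (s * s')"
proof -
  have "qt (t * t') (u * u') = qt (r * r') (s * s')"
    if "(t, u) \<in> qt r s" "(t', u') \<in> qt r' s'" for t u t' u'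
  proof -
    have m: "t \<in> A" "u \<in> S" "r * u = t * s" "t' \<in> A" "u' \<in> S" "r' * u' = t' * s'"
      using that assms by (simp_all add: qt_eq_set)
    have "(t * t') * (s * s') = (t * s) * (t' * s')" by (simp add: ac_simps)
    also have "\<dots> = (r * r') * (u * u')" using m by (simp flip: m(3,6))
    finally show ?thesis using m assms by (subst qt_eq_iff) (auto intro: S_closed)
  qed
  note eq = this
  have "qt r s \<otimes>\<^bsub>L\<^esub> qt r' s' = (\<Union>x\<in>qt r s. \<Union>y\<in>qt r' s'. qt (fst x * fst y) (snd x * snd y))"
    unfolding L_def localization_def by (simp add: qt_def case_prod_unfold)
  also have "\<dots> = (\<Union>x\<in>qt r s. \<Union>y\<in>qt r' s'. qt (r * r') (s * s'))"
    using eq by (intro SUP_cong refl) simp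
  also have "\<dots> = qt (r * r') (s * s')"
    using qt_self assms by auto
  finally show ?thesis .
qed

lemma add_qt:
  assumes "r \<in> A" "s \<in> S" "r' \<in> A" "s' \<in> S"
  shows "qt r s \<oplus>\<^bsub>L\<^esub> qt r' s' = qt (r * s' + r' * s) (s * s')"
proof -
  have "qt (t * u' + t' * u) (u * u') = qt (r * s' + r' * s) (s * s')"
    if "(t, u) \<in> qt r s" "(t', u') \<in> qt r' s'" for t u t' u'
  proof -
    have m: "t \<in> A" "u \<in> S" "r * u = t * s" "t' \<in> A" "u' \<in> S" "r' * u' = t' * s'"
      using that assms by (simp_all add: qt_eq_set)
    have "(t * u' + t' * u) * (s * s') = (t * s) * (u' * s') + (t' * s') * (u * s)"
      by (simp add: algebra_simps)
    also have "\<dots> = (r * u) * (u' * s') + (r' * u') * (u * s)"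
      by (simp only: m(3,6))
    also have "\<dots> = (r * s' + r' * s) * (u * u')"
      by (simp add: algebra_simps)
    finally show ?thesis using m assms S_D by (subst qt_eq_iff) (auto intro: S_closed)
  qed
  note eq = this
  have "qt r s \<oplus>\<^bsub>L\<^esub> qt r' s' = (\<Union>x\<in>qt r s. \<Union>y\<in>qt r' s'. qt (fst x * snd y + fst y * snd x) (snd x * snd y))"
    unfolding L_def localization_def by (simp add: qt_def case_prod_unfold)
  also have "\<dots> = (\<Union>x\<in>qt r s. \<Union>y\<in>qt r' s'. qt (r * s' + r' * s) (s * s'))"
    using eq by (intro SUP_cong refl) simp
  also have "\<dots> = qt (r * s' + r' * s) (s * s')"
    using qt_self assms by auto
  finally show ?thesis .
qed

lemma cring_L: "cring L"
proof (intro cringI abelian_groupI comm_monoidI)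
  fix x assume "x \<in> carrier L"
  then obtain r s where x: "x = qt r s" "r \<in> A" "s \<in> S" by (auto simp: carrier_L)
  then have "qt (- r) s \<oplus>\<^bsub>L\<^esub> x = \<zero>\<^bsub>L\<^esub>"
    using S_D S_closed
    by (simp add: add_qt zero_L) (subst qt_eq_iff, auto)
  then show "\<exists>y\<in>carrier L. y \<oplus>\<^bsub>L\<^esub> x = \<zero>\<^bsub>L\<^esub>"
    using x by (intro bexI[of _ "qt (- r) s"]) (auto intro: qt_closed)
next
  fix x y z assume "x \<in> carrier L" "y \<in> carrier L" "z \<in> carrier L"
  then obtain r s t u v w where "x = qt r s" "y = qt t u" "z = qt v w"
    "r \<in> A" "t \<in> A" "v \<in> A" "s \<in> S" "u \<in> S" "w \<in> S"
    unfolding carrier_L by blast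
  then show "(x \<oplus>\<^bsub>L\<^esub> y) \<otimes>\<^bsub>L\<^esub> z = x \<otimes>\<^bsub>L\<^esub> z \<oplus>\<^bsub>L\<^esub> y \<otimes>\<^bsub>L\<^esub> z"
    using S_D(1) S_closed(2)
    by (simp add: add_qt mult_qt, subst qt_eq_iff) (auto simp: algebra_simps)
next
  fix x y assume "x \<in> carrier L" "y \<in> carrier L"
  then obtain r s t u where "x = qt r s" "y = qt t u" "r \<in> A" "t \<in> A" "s \<in> S" "u \<in> S"
    unfolding carrier_L by blast
  then show "x \<oplus>\<^bsub>L\<^esub> y \<in> carrier L" "x \<otimes>\<^bsub>L\<^esub> y \<in> carrier L"
    using S_D(1) S_closed(2) by (auto simp: add_qt mult_qt intro!: qt_closed)
next
  show "\<zero>\<^bsub>L\<^esub> \<in> carrier L" "\<one>\<^bsub>L\<^esub> \<in> carrier L"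
    using S_closed(1) by (auto simp: one_L zero_L intro: qt_closed)
qed (auto simp: carrier_L one_L zero_L add_qt mult_qt S_closed S_D qt_eq_iff algebra_simps)

sublocale L: cring L
  by (rule cring_L)

lemma inv_qt: "r \<in> A \<Longrightarrow> s \<in> S \<Longrightarrow> \<ominus>\<^bsub>L\<^esub> qt r s = qt (- r) s"
  by (rule L.minus_equality)
    (auto simp: add_qt zero_L S_D S_closed qt_eq_iff intro: qt_closed)

lemma minus_qt:
  "r \<in> A \<Longrightarrow> s \<in> S \<Longrightarrow> r' \<in> A \<Longrightarrow> s' \<in> S \<Longrightarrow>
     qt r s \<ominus>\<^bsub>L\<^esub> qt r' s' = qt (r * s' - r' * s) (s * s')"
  by (simp add: a_minus_def inv_qt add_qt)

lemma pow_qt: "r \<in> A \<Longrightarrow> s \<in> S \<Longrightarrow> qt r s [^]\<^bsub>L\<^esub> (k::nat) = qt (r ^ k) (s ^ k)"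
proof (induction k)
  case 0 then show ?case by (simp add: one_L)
next
  case (Suc k)
  have "s ^ k \<in> S" using Suc.prems(2) by (induction k) (auto intro: S_closed)
  then show ?case using Suc by (simp add: mult_qt mult.commute)
qed

text \<open>This removes fractions: every local condition below is tested in \<open>A\<close> up to
  a factor outside \<open>P\<close>. For the forward direction the denominator of the representative
  in \<open>I\<close> serves as \<open>u\<close>.\<close>

lemma qt_mem_ext_iff:
  assumes "ideal I (ring_on A)" "r \<in> A" "s \<in> S"
  shows "qt r s \<in> ext I \<longleftrightarrow> (\<exists>u\<in>S. u * r \<in> I)"
proof
  assume "qt r s \<in> ext I"
  then obtain r' s' where "qt r s = qt r' s'" "r' \<in> I" "s' \<in> S" by (auto simp: ext_def)
  then have "r * s' = r' * s" using assms idealD(1)[OF assms(1)] by (subst (asm) qt_eq_iff) auto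
  then have "s' * r = s * r'" by (simp add: mult.commute)
  then have "s' * r \<in> I" using idealD(4)[OF assms(1)] S_D assms(3) \<open>r' \<in> I\<close> by simp
  then show "\<exists>u\<in>S. u * r \<in> I" using \<open>s' \<in> S\<close> by blast
next
  assume "\<exists>u\<in>S. u * r \<in> I"
  then obtain u where u: "u \<in> S" "u * r \<in> I" by blast
  have "qt r s = qt (u * r) (u * s)"
    using assms u S_D by (subst qt_eq_iff) (auto intro: S_closed)
  then show "qt r s \<in> ext I" using u assms S_closed unfolding ext_def by blast
qed

section \<open>Extension and contraction of ideals\<close>

lemma ext_ideal:
  assumes I: "ideal I (ring_on A)"
  shows "ideal (ext I) L"
proof (intro idealI L.ring_axioms L.add.subgroupI)
  show sub: "ext I \<subseteq> carrier L" using idealD(1)[OF I] by (auto simp: ext_def carrier_L)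
  show "ext I \<noteq> {}" using idealD(2)[OF I] S_closed(1) by (auto simp: ext_def)
  fix a assume "a \<in> ext I"
  then obtain r s where a: "a = qt r s" "r \<in> I" "s \<in> S" by (auto simp: ext_def)
  then have rA: "r \<in> A" using idealD(1)[OF I] by blast
  have "- r \<in> I" using idealD(5)[OF I idealD(2)[OF I] a(2)] by simp
  then show "\<ominus>\<^bsub>L\<^esub> a \<in> ext I" using a rA by (auto simp: inv_qt ext_def)
  { fix b assume "b \<in> ext I"
    then obtain r' s' where b: "b = qt r' s'" "r' \<in> I" "s' \<in> S" by (auto simp: ext_def)
    then have "r' \<in> A" using idealD(1)[OF I] by blast
    moreover have "s' * r + s * r' \<in> I"
      using idealD(3)[OF I idealD(4)[OF I S_D(1)[OF b(3)] a(2)] idealD(4)[OF I S_D(1)[OF a(3)] b(2)]] .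
    moreover have "s' * r + s * r' = r * s' + r' * s" by (simp add: mult.commute)
    ultimately show "a \<oplus>\<^bsub>L\<^esub> b \<in> ext I"
      using a b rA S_closed(2) by (auto simp: add_qt ext_def) }
  { fix x assume "x \<in> carrier L"
    then obtain r' s' where x: "x = qt r' s'" "r' \<in> A" "s' \<in> S" by (auto simp: carrier_L)
    then have "r' * r \<in> I" using a(2) idealD(4)[OF I] by simp
    then show "x \<otimes>\<^bsub>L\<^esub> a \<in> ext I" "a \<otimes>\<^bsub>L\<^esub> x \<in> ext I"
      using a x rA S_closed(2) by (auto simp: mult_qt ext_def mult.commute) }
qed

definition "contr J = {r \<in> A. qt r 1 \<in> J}"

lemma mem_ideal_L:
  assumes "ideal J L" "r \<in> A" "s \<in> S"
  shows "qt r s \<in> J \<longleftrightarrow> qt r 1 \<in> J"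
proof
  assume "qt r s \<in> J"
  then have "qt s 1 \<otimes>\<^bsub>L\<^esub> qt r s \<in> J"
    using assms S_D S_closed by (intro ideal.I_l_closed) (auto intro: qt_closed)
  moreover have "qt s 1 \<otimes>\<^bsub>L\<^esub> qt r s = qt r 1"
    using assms S_D S_closed by (simp add: mult_qt qt_eq_iff)
  ultimately show "qt r 1 \<in> J" by simp
next
  assume "qt r 1 \<in> J"
  then have "qt 1 s \<otimes>\<^bsub>L\<^esub> qt r 1 \<in> J"
    using assms S_D S_closed by (intro ideal.I_l_closed) (auto intro: qt_closed)
  then show "qt r s \<in> J" using assms S_D S_closed by (simp add: mult_qt)
qed

lemma contr_ideal:
  assumes J: "ideal J L"
  shows "ideal (contr J) (ring_on A)"
  unfolding ideal_iff
proof (intro conjI ballI)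
  interpret J: ideal J L by fact
  show "contr J \<subseteq> A" by (auto simp: contr_def)
  show "0 \<in> contr J" using additive_subgroup.zero_closed[OF J.is_additive_subgroup]
    by (simp add: contr_def zero_L)
  fix x y assume "x \<in> contr J" "y \<in> contr J"
  then show "x + y \<in> contr J"
    using J.a_closed[of "qt x 1" "qt y 1"] S_closed by (simp add: contr_def add_qt)
next
  interpret J: ideal J L by fact
  fix r x assume "r \<in> A" "x \<in> contr J"
  then show "r * x \<in> contr J"
    using J.I_l_closed[of "qt x 1" "qt r 1"] S_closed
    by (simp add: contr_def mult_qt qt_closed)
qed

lemma ext_contr:
  assumes J: "ideal J L"
  shows "ext (contr J) = J"
proof
  show "ext (contr J) \<subseteq> J" using mem_ideal_L[OF J] by (auto simp: ext_def contr_def)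
  show "J \<subseteq> ext (contr J)"
  proof
    fix x assume x: "x \<in> J"
    then have "x \<in> carrier L" using ideal.Icarr[OF J] by blast
    then obtain r s where "x = qt r s" "r \<in> A" "s \<in> S" by (auto simp: carrier_L)
    then show "x \<in> ext (contr J)" using x mem_ideal_L[OF J] by (auto simp: ext_def contr_def)
  qed
qed

lemma gen_ext:
  assumes X: "X \<subseteq> A"
  shows "Idl\<^bsub>L\<^esub> ((\<lambda>x. qt x 1) ` X) = ext (Idl\<^bsub>ring_on A\<^esub> X)" (is "Idl\<^bsub>L\<^esub> ?X = ext ?I")
proof
  have XL: "?X \<subseteq> carrier L" using X S_closed by (auto intro: qt_closed)
  have "?X \<subseteq> ext ?I" using gen_incl[OF X] S_closed(1) by (auto simp: ext_def)
  then show "Idl\<^bsub>L\<^esub> ?X \<subseteq> ext ?I" by (intro L.genideal_minimal ext_ideal gen_ideal X)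
  have J: "ideal (Idl\<^bsub>L\<^esub> ?X) L" by (rule L.genideal_ideal[OF XL])
  have "X \<subseteq> contr (Idl\<^bsub>L\<^esub> ?X)" using L.genideal_self[OF XL] X by (auto simp: contr_def)
  then have "?I \<subseteq> contr (Idl\<^bsub>L\<^esub> ?X)" by (intro gen_least contr_ideal J)
  then have "ext ?I \<subseteq> ext (contr (Idl\<^bsub>L\<^esub> ?X))" by (auto simp: ext_def)
  then show "ext ?I \<subseteq> Idl\<^bsub>L\<^esub> ?X" by (simp add: ext_contr[OF J])
qed

text \<open>Every ideal of \<open>L\<close> is the extension of its contraction, and generators of
  the contraction remain generators after extension.\<close>

lemma noetherian_L:
  assumes "noetherian_ring (ring_on A)"
  shows "noetherian_ring L"
proof (rule L.noetherian_ringI)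
  fix J assume J: "ideal J L"
  obtain X where X: "X \<subseteq> A" "finite X" "contr J = Idl\<^bsub>ring_on A\<^esub> X"
    using noetherian_ring.finetely_gen[OF assms contr_ideal[OF J]] by auto
  have "J = Idl\<^bsub>L\<^esub> ((\<lambda>x. qt x 1) ` X)" using ext_contr[OF J] gen_ext[OF X(1)] X(3) by simp
  then show "\<exists>Y\<subseteq>carrier L. finite Y \<and> J = Idl\<^bsub>L\<^esub> Y"
    using X S_closed(1) by (intro exI[of _ "(\<lambda>x. qt x 1) ` X"]) (auto intro: qt_closed)
qed

lemma qt_in_ext_P: "r \<in> A \<Longrightarrow> s \<in> S \<Longrightarrow> qt r s \<in> ext P \<longleftrightarrow> r \<in> P"
  using qt_mem_ext_iff[OF P_ideal] P_prime S_closed(1)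
  by (auto simp: S_def intro!: bexI[of _ 1])

text \<open>A fraction with numerator outside \<open>P\<close> is a unit, inverted by exchanging
  numerator and denominator.\<close>

lemma proper_ideal_L:
  assumes J: "ideal J L" "J \<noteq> carrier L"
  shows "J \<subseteq> ext P"
proof
  fix x assume x: "x \<in> J"
  then have "x \<in> carrier L" using ideal.Icarr[OF J(1)] by blast
  then obtain r s where r: "x = qt r s" "r \<in> A" "s \<in> S" by (auto simp: carrier_L)
  have "r \<in> P"
  proof (rule ccontr)
    assume "r \<notin> P"
    then have rS: "r \<in> S" using r by (simp add: S_def)
    then have "qt s r \<otimes>\<^bsub>L\<^esub> x \<in> J" using x J r S_D by (intro ideal.I_l_closed) (auto intro: qt_closed)
    moreover have "qt s r \<otimes>\<^bsub>L\<^esub> x = \<one>\<^bsub>L\<^esub>"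
      using r rS S_D S_closed by (simp add: mult_qt one_L qt_eq_iff mult.commute)
    ultimately show False using ideal.one_imp_carrier[OF J(1)] J(2) by simp
  qed
  then show "x \<in> ext P" using r by (auto simp: ext_def)
qed

lemma maximal_ext_P: "maximalideal (ext P) L" "maximalideal J L \<Longrightarrow> J = ext P"
proof -
  have ne: "carrier L \<noteq> ext P"
    using qt_in_ext_P[of 1 1] one_notin_P S_closed(1) qt_closed[of 1 1] by auto
  show "maximalideal (ext P) L"
    using proper_ideal_L ne by (intro maximalidealI ext_ideal P_ideal) auto
  show "J = ext P" if "maximalideal J L"
  proof -
    interpret J: maximalideal J L by fact
    have "J \<subseteq> ext P" using proper_ideal_L[OF J.is_ideal] J.I_notcarr by auto
    then show ?thesis using J.I_maximal[OF ext_ideal[OF P_ideal]] ne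
        ideal.Icarr[OF ext_ideal[OF P_ideal]] by blast
  qed
qed

lemma noetherian_local_L: "noetherian_ring (ring_on A) \<Longrightarrow> noetherian_local_ring L (ext P)"
  unfolding noetherian_local_ring_def using cring_L noetherian_L maximal_ext_P by blast

text \<open>The local conditions are pulled back to \<open>A\<close> with denominators cleared.
  Regularity is assumed in \<open>A\<close> itself and passes to the localization by applying it to
  \<open>u * r\<close>, where \<open>u\<close> clears the denominators.\<close>

lemma gorenstein_localizationI:
  assumes noeth: "noetherian_ring (ring_on A)"
    and xs: "set xs \<subseteq> P"
    and regular: "\<And>i r. i < length xs \<Longrightarrow> r \<in> A \<Longrightarrow>
      xs ! i * r \<in> Idl\<^bsub>ring_on A\<^esub> (set (take i xs)) \<Longrightarrow> r \<in> Idl\<^bsub>ring_on A\<^esub> (set (take i xs))"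
    and primary: "\<And>r. r \<in> P \<Longrightarrow> \<exists>k. \<exists>u\<in>A - P. u * r ^ k \<in> Idl\<^bsub>ring_on A\<^esub> (set xs)"
    and s: "s \<in> A" "\<And>u. u \<in> A - P \<Longrightarrow> u * s \<notin> Idl\<^bsub>ring_on A\<^esub> (set xs)"
      "\<And>y. y \<in> P \<Longrightarrow> \<exists>u\<in>A - P. u * (y * s) \<in> Idl\<^bsub>ring_on A\<^esub> (set xs)"
    and span: "\<And>t. t \<in> A \<Longrightarrow> \<forall>y\<in>P. \<exists>u\<in>A - P. u * (y * t) \<in> Idl\<^bsub>ring_on A\<^esub> (set xs) \<Longrightarrow>
      \<exists>c\<in>A. \<exists>u\<in>A - P. u * (t - c * s) \<in> Idl\<^bsub>ring_on A\<^esub> (set xs)"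
  shows "gorenstein_local_ring (localization (ring_on A) P)"
proof -
  let ?f = "\<lambda>x. qt x 1"
  let ?I = "Idl\<^bsub>ring_on A\<^esub> (set xs)"
  have PA: "P \<subseteq> A" using idealD(1)[OF P_ideal] .
  have takeA: "set (take i xs) \<subseteq> A" for i using xs PA set_take_subset[of i xs] by blast
  have gen_take: "Idl\<^bsub>L\<^esub> (set (take i (map ?f xs))) = ext (Idl\<^bsub>ring_on A\<^esub> (set (take i xs)))" for i
    using gen_ext[OF takeA[of i]] by (simp add: take_map)
  have I: "ideal ?I (ring_on A)" using gen_ideal xs PA by auto
  have gen: "Idl\<^bsub>L\<^esub> (set (map ?f xs)) = ext ?I"
    using gen_ext[of "set xs"] xs PA by simp
  have S_eq: "A - P = S" by (simp add: S_def)
  have "regular_sequence L (ext P) (map ?f xs)"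
    unfolding regular_sequence_def
  proof (intro conjI allI impI ballI)
    show "set (map ?f xs) \<subseteq> ext P" using xs S_closed(1) by (auto simp: ext_def)
    fix i z assume i: "i < length (map ?f xs)" and z: "z \<in> carrier L"
      and mem: "map ?f xs ! i \<otimes>\<^bsub>L\<^esub> z \<in> Idl\<^bsub>L\<^esub> (set (take i (map ?f xs)))"
    let ?J = "Idl\<^bsub>ring_on A\<^esub> (set (take i xs))"
    have J: "ideal ?J (ring_on A)" by (rule gen_ideal[OF takeA])
    obtain r t where r: "z = qt r t" "r \<in> A" "t \<in> S" using z by (auto simp: carrier_L)
    have "xs ! i \<in> set xs" using i by simp
    then have xi: "xs ! i \<in> A" using xs PA by blast
    have "qt (xs ! i * r) t \<in> ext ?J"
      using mem i r xi S_closed(1) unfolding gen_take by (simp add: mult_qt)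
    then obtain u where u: "u \<in> S" "u * (xs ! i * r) \<in> ?J"
      using qt_mem_ext_iff[OF J] r xi by auto
    then have "xs ! i * (u * r) \<in> ?J" by (simp add: ac_simps)
    then have "u * r \<in> ?J" using regular i r u S_D by simp
    then show "z \<in> Idl\<^bsub>L\<^esub> (set (take i (map ?f xs)))"
      unfolding gen_take using u r qt_mem_ext_iff[OF J] by auto
  qed
  moreover have "max_primary L (ext P) (ext ?I)"
    unfolding max_primary_def
  proof (intro conjI ballI)
    show "ideal (ext ?I) L" by (rule ext_ideal[OF I])
    show "ext ?I \<subseteq> ext P" using gen_least[OF P_ideal xs] by (auto simp: ext_def)
    fix z assume "z \<in> ext P"
    then obtain r t where r: "z = qt r t" "r \<in> P" "t \<in> S" by (auto simp: ext_def)
    obtain k u where u: "u \<in> S" "u * r ^ k \<in> ?I" using primary[OF r(2)] unfolding S_eq by blast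
    have tk: "t ^ k \<in> S" using r(3) by (induction k) (auto intro: S_closed)
    have rA: "r \<in> A" using r(2) PA by blast
    have "z [^]\<^bsub>L\<^esub> k = qt (r ^ k) (t ^ k)" using r rA by (simp add: pow_qt)
    also have "\<dots> \<in> ext ?I" using qt_mem_ext_iff[OF I] rA tk u by auto
    finally show "\<exists>k::nat. z [^]\<^bsub>L\<^esub> k \<in> ext ?I" by blast
  qed
  moreover have "simple_socle L (ext P) (ext ?I)"
    unfolding simple_socle_def
  proof (rule bexI[of _ "qt s 1"], intro ballI)
    have colon: "qt r t \<in> colon_max L (ext P) (ext ?I) \<longleftrightarrow> (\<forall>y\<in>P. \<exists>u\<in>S. u * (y * r) \<in> ?I)"
      if "r \<in> A" "t \<in> S" for r t
    proof -
      have "qt r t \<in> colon_max L (ext P) (ext ?I) \<longleftrightarrow>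
          (\<forall>y\<in>P. \<forall>v\<in>S. qt y v \<otimes>\<^bsub>L\<^esub> qt r t \<in> ext ?I)"
        unfolding colon_max_def using that by (auto simp: ext_def qt_closed)
      also have "\<dots> \<longleftrightarrow> (\<forall>y\<in>P. \<forall>v\<in>S. \<exists>u\<in>S. u * (y * r) \<in> ?I)"
      proof (intro ball_cong refl)
        fix y v assume "y \<in> P" "v \<in> S"
        then show "qt y v \<otimes>\<^bsub>L\<^esub> qt r t \<in> ext ?I \<longleftrightarrow> (\<exists>u\<in>S. u * (y * r) \<in> ?I)"
          using that PA S_closed(2) by (subst mult_qt, auto, subst (asm) qt_mem_ext_iff[OF I], auto, subst qt_mem_ext_iff[OF I], auto)
      qed
      also have "\<dots> \<longleftrightarrow> (\<forall>y\<in>P. \<exists>u\<in>S. u * (y * r) \<in> ?I)" using S_closed(1) by blast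
      finally show ?thesis .
    qed
    show "qt s 1 \<in> colon_max L (ext P) (ext ?I) - ext ?I"
      using colon[OF s(1) S_closed(1)] qt_mem_ext_iff[OF I s(1) S_closed(1)] s(2,3)
      unfolding S_eq by blast
    fix z assume z: "z \<in> colon_max L (ext P) (ext ?I)"
    then have "z \<in> carrier L" by (simp add: colon_max_def)
    then obtain r t where r: "z = qt r t" "r \<in> A" "t \<in> S" by (auto simp: carrier_L)
    then have "\<forall>y\<in>P. \<exists>u\<in>S. u * (y * r) \<in> ?I" using z colon by blast
    then obtain c u where c: "c \<in> A" "u \<in> S" "u * (r - c * s) \<in> ?I"
      using span[OF r(2)] unfolding S_eq by blast
    have "z \<ominus>\<^bsub>L\<^esub> qt c t \<otimes>\<^bsub>L\<^esub> qt s 1 = qt (r * t - c * s * t) (t * t)"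
      using r c s S_closed(1) by (simp add: mult_qt minus_qt)
    also have "\<dots> = qt (r - c * s) t"
      using r c s S_closed S_D by (subst qt_eq_iff) (auto simp: algebra_simps)
    also have "\<dots> \<in> ext ?I" using qt_mem_ext_iff[OF I] r c s by auto
    finally show "\<exists>c\<in>carrier L. z \<ominus>\<^bsub>L\<^esub> c \<otimes>\<^bsub>L\<^esub> qt s 1 \<in> ext ?I"
      using c r qt_closed by blast
  qed
  ultimately show ?thesis
    unfolding gorenstein_local_ring_def L_def[symmetric]
    using noetherian_local_L[OF noeth] gen by metis
qed

end

context prime_of_subring
begin

text \<open>The hypotheses say that \<open>A/I\<close> is an algebraic Frobenius algebra over \<open>'k\<close> and that \<open>P\<close> is a
  rational point. An element \<open>t\<close> of the socle at \<open>P\<close> is annihilated by \<open>P\<close> after multiplication by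
  some \<open>u \<notin> P\<close>, so \<open>u t A\<close> is a line modulo \<open>I\<close> and \<open>t \<mapsto> lam (u t)\<close> detects whether \<open>t\<close> vanishes.\<close>

theorem gorenstein_of_frobenius:
  fixes emb :: "'k::field \<Rightarrow> 'a" and lam :: "'a \<Rightarrow> 'k"
  assumes noeth: "noetherian_ring (ring_on A)"
    and xs: "set xs \<subseteq> P"
    and regular: "\<And>i r. i < length xs \<Longrightarrow> r \<in> A \<Longrightarrow>
      xs ! i * r \<in> Idl\<^bsub>ring_on A\<^esub> (set (take i xs)) \<Longrightarrow> r \<in> Idl\<^bsub>ring_on A\<^esub> (set (take i xs))"
    and emb: "emb 0 = 0" "emb 1 = 1" "\<And>c d. emb (c * d) = emb c * emb d" "\<And>c. emb c \<in> A"
    and rational: "\<And>r. r \<in> A \<Longrightarrow> \<exists>c. r - emb c \<in> P"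
    and algebraic: "\<And>r. r \<in> A \<Longrightarrow>
      \<exists>f. f \<noteq> 0 \<and> poly (map_poly emb f) r \<in> Idl\<^bsub>ring_on A\<^esub> (set xs)"
    and lam: "\<And>x y. lam (x - y) = lam x - lam y" "\<And>c x. lam (emb c * x) = c * lam x"
      "\<And>x. x \<in> Idl\<^bsub>ring_on A\<^esub> (set xs) \<Longrightarrow> lam x = 0"
    and nondegenerate: "\<And>x. x \<in> A \<Longrightarrow> (\<And>r. r \<in> A \<Longrightarrow> lam (x * r) = 0) \<Longrightarrow>
      x \<in> Idl\<^bsub>ring_on A\<^esub> (set xs)"
  shows "gorenstein_local_ring (localization (ring_on A) P)"
proof -
  let ?I = "Idl\<^bsub>ring_on A\<^esub> (set xs)"
  have PA: "P \<subseteq> A" using idealD(1)[OF P_ideal] .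
  have I: "ideal ?I (ring_on A)" using gen_ideal xs PA by auto
  have IP: "?I \<subseteq> P" using gen_least[OF P_ideal xs] .
  have S_eq: "A - P = S" by (simp add: S_def)
  obtain Y where Y: "finite Y" "Y \<subseteq> A" "P = Idl\<^bsub>ring_on A\<^esub> Y"
    using noetherian_ring.finetely_gen[OF noeth P_ideal] by auto
  have YP: "Y \<subseteq> P" using gen_incl[OF Y(2)] Y(3) by simp
  have emb_unit: "emb c \<notin> P" if "c \<noteq> 0" for c
  proof
    assume "emb c \<in> P"
    then have "emb (inverse c) * emb c \<in> P" using idealD(4)[OF P_ideal emb(4)] by blast
    then show False using emb(3)[of "inverse c" c, symmetric] that emb(2) one_notin_P by simp
  qed
  have emb_poly: "poly (map_poly emb f) r \<in> A" if "r \<in> A" for f r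
    using that emb(1,4) by (auto simp: poly_altdef coeff_map_poly intro!: sum_closed mult_closed)
  \<comment> \<open>Powers of \<open>r\<close> are stripped from an annihilating polynomial until
    the constant term \<open>a\<close> is nonzero. The remaining value at \<open>r\<close> is
    congruent to \<open>emb a\<close> modulo \<open>P\<close>, hence lies outside \<open>P\<close>
    and serves as \<open>u\<close>; the stripped powers are collected in the exponent
    \<open>j\<close>.\<close>
  have nilpotent: "\<exists>k. \<exists>u\<in>S. u * r ^ k \<in> ?I" if r: "r \<in> P" for r
  proof -
    have rA: "r \<in> A" using r PA by blast
    have "f \<noteq> 0 \<Longrightarrow> poly (map_poly emb f) r * r ^ j \<in> ?I \<Longrightarrow> \<exists>k. \<exists>u\<in>S. u * r ^ k \<in> ?I" for f j
    proof (induction f arbitrary: j)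
      case (pCons a f)
      have eq: "poly (map_poly emb (pCons a f)) r = emb a + r * poly (map_poly emb f) r"
        using pCons.hyps emb(1) by (simp add: map_poly_pCons)
      show ?case
      proof (cases "a = 0")
        case True
        then have "f \<noteq> 0" "poly (map_poly emb f) r * r ^ Suc j \<in> ?I"
          using pCons.hyps pCons.prems eq emb(1) by (simp_all add: ac_simps)
        then show ?thesis using pCons.IH by blast
      next
        case False
        have "emb a + r * poly (map_poly emb f) r \<notin> P"
        proof
          assume *: "emb a + r * poly (map_poly emb f) r \<in> P"
          have "poly (map_poly emb f) r * r \<in> P"
            using idealD(4)[OF P_ideal emb_poly[OF rA] r] .
          from idealD(5)[OF P_ideal * this] show False
            using emb_unit[OF False] by (simp add: mult.commute)
        qed
        then have "poly (map_poly emb (pCons a f)) r \<in> S"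
          unfolding S_def using emb_poly[OF rA] emb(4) rA eq by simp
        then show ?thesis using pCons.prems(2) by blast
      qed
    qed simp
    then show ?thesis using algebraic[OF rA] by (metis power_0 mult.right_neutral)
  qed
  \<comment> \<open>The contraction to \<open>A\<close> of the ideal generated by \<open>?I\<close>
    in the localization: \<open>x \<notin> Q\<close> says that \<open>x\<close> does not vanish in
    the local factor at \<open>P\<close>.\<close>
  define Q where "Q = {x \<in> A. \<exists>u\<in>S. u * x \<in> ?I}"
  have Q_ideal: "ideal Q (ring_on A)"
    unfolding ideal_iff
  proof (intro conjI ballI)
    show "Q \<subseteq> A" by (auto simp: Q_def)
    show "0 \<in> Q" using S_closed(1) idealD(2)[OF I] by (auto simp: Q_def)
    fix x y assume "x \<in> Q" "y \<in> Q"
    then obtain u v where *: "x \<in> A" "y \<in> A" "u \<in> S" "v \<in> S" "u * x \<in> ?I" "v * y \<in> ?I"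
      by (auto simp: Q_def)
    have "v * (u * x) + u * (v * y) \<in> ?I"
      using idealD(3)[OF I idealD(4)[OF I S_D(1)[OF *(4)] *(5)] idealD(4)[OF I S_D(1)[OF *(3)] *(6)]] .
    then have "(u * v) * (x + y) \<in> ?I" by (simp add: algebra_simps)
    then show "x + y \<in> Q"
      using add_closed[OF *(1,2)] S_closed(2)[OF *(3,4)] unfolding Q_def by blast
  next
    fix r x assume r: "r \<in> A" and "x \<in> Q"
    then obtain u where *: "x \<in> A" "u \<in> S" "u * x \<in> ?I" by (auto simp: Q_def)
    have "r * (u * x) \<in> ?I" using idealD(4)[OF I r *(3)] .
    then have "u * (r * x) \<in> ?I" by (simp add: ac_simps)
    then show "r * x \<in> Q"
      using mult_closed[OF r *(1)] *(2) unfolding Q_def by blast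
  qed
  \<comment> \<open>A socle element is built from \<open>1\<close> by treating the generators of
    \<open>P\<close> in turn: \<open>s\<close> is multiplied by the highest power of
    \<open>y\<close> that keeps it outside \<open>Q\<close>. Such a power exists because
    \<open>y\<close> is nilpotent in the local factor, and generators treated before still
    annihilate the product.\<close>
  have "\<exists>s\<in>A - Q. \<forall>y\<in>Y. y * s \<in> Q"
    using Y(1) YP
  proof (induction Y)
    case empty
    have "u \<notin> ?I" if "u \<in> S" for u using that IP by (auto simp: S_def)
    then have "1 \<notin> Q" by (auto simp: Q_def)
    then show ?case by (intro bexI[of _ 1]) auto
  next
    case (insert y Y)
    then obtain s where s: "s \<in> A" "s \<notin> Q" "\<forall>z\<in>Y. z * s \<in> Q" by auto
    have yA: "y \<in> A" using insert.prems PA by blast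
    obtain k u where u: "u \<in> S" "u * y ^ k \<in> ?I" using nilpotent insert.prems by blast
    have "s * (u * y ^ k) \<in> ?I" using idealD(4)[OF I s(1) u(2)] .
    then have "u * (y ^ k * s) \<in> ?I" by (simp add: ac_simps)
    then have ex: "y ^ k * s \<in> Q" using u s(1) yA by (auto simp: Q_def)
    define m where "m = (LEAST k. y ^ k * s \<in> Q)"
    have m: "y ^ m * s \<in> Q" unfolding m_def by (rule LeastI[of _ k]) (rule ex)
    have "m \<noteq> 0" using m s(2) by (cases m) auto
    then obtain l where l: "m = Suc l" by (cases m) auto
    have "y ^ l * s \<notin> Q" using l not_less_Least[of l "\<lambda>k. y ^ k * s \<in> Q"] unfolding m_def[symmetric] by simp
    moreover have "y * (y ^ l * s) \<in> Q" using m l by (simp add: ac_simps)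
    moreover have "z * (y ^ l * s) \<in> Q" if "z \<in> Y" for z
    proof -
      have "y ^ l * (z * s) \<in> Q" using idealD(4)[OF Q_ideal, of "y ^ l" "z * s"] yA s(3) that by simp
      then show ?thesis by (simp add: ac_simps)
    qed
    ultimately show ?case using yA s(1) by (intro bexI[of _ "y ^ l * s"]) auto
  qed
  then obtain s where s: "s \<in> A" "s \<notin> Q" "\<forall>y\<in>Y. y * s \<in> Q" by blast
  \<comment> \<open>A single \<open>u\<close> works for all of \<open>P\<close>: the product of the
    factors belonging to the finitely many generators in \<open>Y\<close>.\<close>
  have uniform: "\<exists>u\<in>S. \<forall>y\<in>P. u * (y * t) \<in> ?I"
    if t: "t \<in> A" and ann: "\<forall>y\<in>Y. \<exists>u\<in>S. u * (y * t) \<in> ?I" for t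
  proof -
    obtain w where w: "\<And>y. y \<in> Y \<Longrightarrow> w y \<in> S \<and> w y * (y * t) \<in> ?I" using ann by metis
    define u where "u = prod w Y"
    have u: "u \<in> S" unfolding u_def using S_prod[OF Y(1)] w by blast
    have "u * (y * t) \<in> ?I" if y: "y \<in> Y" for y
    proof -
      have "prod w (Y - {y}) \<in> A" using w S_D(1) by (intro prod_closed) blast
      then have "prod w (Y - {y}) * (w y * (y * t)) \<in> ?I" using w[OF y] idealD(4)[OF I] by blast
      then show ?thesis unfolding u_def using prod.remove[OF Y(1) y, of w] by (simp add: ac_simps)
    qed
    then have Y_sub: "Y \<subseteq> {y \<in> A. u * (y * t) \<in> ?I}" using Y(2) by blast
    have "ideal {y \<in> A. u * (y * t) \<in> ?I} (ring_on A)"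
      unfolding ideal_iff
    proof (intro conjI ballI)
      show "0 \<in> {y \<in> A. u * (y * t) \<in> ?I}" using idealD(2)[OF I] by simp
      fix x y assume *: "x \<in> {y \<in> A. u * (y * t) \<in> ?I}" "y \<in> {y \<in> A. u * (y * t) \<in> ?I}"
      then have "u * (x * t) + u * (y * t) \<in> ?I" using idealD(3)[OF I] by blast
      then show "x + y \<in> {y \<in> A. u * (y * t) \<in> ?I}" using * by (simp add: algebra_simps)
    next
      fix r y assume *: "r \<in> A" "y \<in> {y \<in> A. u * (y * t) \<in> ?I}"
      then have "r * (u * (y * t)) \<in> ?I" using idealD(4)[OF I] by blast
      then show "r * y \<in> {y \<in> A. u * (y * t) \<in> ?I}" using * by (simp add: ac_simps)
    qed auto
    from gen_least[OF this Y_sub] show ?thesis using u Y(3) by blast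
  qed
  \<comment> \<open>Since \<open>P\<close> annihilates \<open>u * x\<close> modulo
    \<open>?I\<close>, each \<open>r\<close> acts on it as the scalar \<open>c\<close> with
    \<open>r - emb c \<in> P\<close>. So \<open>lam\<close> of any multiple of \<open>u * x\<close>
    is a scalar times \<open>lam (u * x)\<close>, and nondegeneracy applies.\<close>
  have detect: "u * x \<in> ?I" if x: "x \<in> A" "u \<in> S" "\<forall>y\<in>P. u * (y * x) \<in> ?I" "lam (u * x) = 0" for u x
  proof (rule nondegenerate)
    show "u * x \<in> A" by (rule mult_closed[OF S_D(1)[OF x(2)] x(1)])
    fix r assume "r \<in> A"
    then obtain c where c: "r - emb c \<in> P" using rational by blast
    then have "u * ((r - emb c) * x) \<in> ?I" using x by blast
    then have "lam (u * x * r - emb c * (u * x)) = 0" using lam(3) by (simp add: algebra_simps)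
    then show "lam (u * x * r) = 0" using lam(1,2) x(4) by simp
  qed
  have s_ann: "\<forall>y\<in>Y. \<exists>u\<in>S. u * (y * s) \<in> ?I" using s(3) by (auto simp: Q_def)
  obtain v where v: "v \<in> S" "\<forall>y\<in>P. v * (y * s) \<in> ?I" using uniform[OF s(1) s_ann] by blast
  show ?thesis
  proof (rule gorenstein_localizationI[OF noeth xs regular, where s = s], goal_cases)
    case (4 r) then show ?case using nilpotent unfolding S_eq by blast
  next
    case 5 show ?case by (rule s(1))
  next
    case (6 u) then show ?case using s(1,2) unfolding S_eq Q_def by blast
  next
    case (7 y) then show ?case using v unfolding S_eq by blast
  next
    case (8 t)
    then obtain w where w: "w \<in> S" "\<forall>y\<in>P. w * (y * t) \<in> ?I"
      using uniform[of t] YP unfolding S_eq by blast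
    define u where "u = v * w"
    have u: "u \<in> S" using v w S_closed(2) by (simp add: u_def)
    have us: "\<forall>y\<in>P. u * (y * s) \<in> ?I"
    proof
      fix y assume "y \<in> P"
      then have "w * (v * (y * s)) \<in> ?I" using v(2) idealD(4)[OF I S_D(1)[OF w(1)]] by blast
      then show "u * (y * s) \<in> ?I" by (simp add: u_def ac_simps)
    qed
    have ut: "\<forall>y\<in>P. u * (y * t) \<in> ?I"
    proof
      fix y assume "y \<in> P"
      then have "v * (w * (y * t)) \<in> ?I" using w(2) idealD(4)[OF I S_D(1)[OF v(1)]] by blast
      then show "u * (y * t) \<in> ?I" by (simp add: u_def ac_simps)
    qed
    \<comment> \<open>Otherwise \<open>detect\<close> would put \<open>u * s\<close> into
      \<open>?I\<close>, against \<open>s \<notin> Q\<close>. Hence \<open>lam\<close> is a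
      coordinate on the line of \<open>u * s\<close>, and the ratio \<open>c\<close> is the scalar
      for which \<open>lam\<close> vanishes on \<open>u * (t - emb c * s)\<close>. The common factor
      \<open>u = v * w\<close> clears \<open>s\<close> and \<open>t\<close> simultaneously.\<close>
    have "lam (u * s) \<noteq> 0" using detect[OF s(1) u us] s(1,2) u unfolding Q_def by blast
    define c where "c = lam (u * t) / lam (u * s)"
    have "u * (t - emb c * s) \<in> ?I"
    proof (rule detect)
      show "t - emb c * s \<in> A" using 8(1) s(1) emb(4) by simp
      show "u \<in> S" by (rule u)
      have "lam (u * (t - emb c * s)) = lam (u * t - emb c * (u * s))" by (simp add: algebra_simps)
      also have "\<dots> = 0" using lam(1,2) \<open>lam (u * s) \<noteq> 0\<close> by (simp add: c_def)
      finally show "lam (u * (t - emb c * s)) = 0" .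
      show "\<forall>y\<in>P. u * (y * (t - emb c * s)) \<in> ?I"
      proof
        fix y assume y: "y \<in> P"
        have "emb c * (u * (y * s)) \<in> ?I" using us y idealD(4)[OF I emb(4)] by blast
        then have "u * (y * t) - emb c * (u * (y * s)) \<in> ?I"
          using ut y idealD(5)[OF I] by blast
        then show "u * (y * (t - emb c * s)) \<in> ?I" by (simp add: algebra_simps)
      qed
    qed
    then show ?case using emb(4) u unfolding S_eq by blast
  qed (assumption+)
qed

end

section \<open>Multivariate polynomials\<close>

text \<open>Gaussian elimination, one coordinate at a time, for more vectors than coordinates. It
  serves the resolvents in \<open>rational_point\<close> and the powers in
  \<open>algebraic_mod_pars\<close>.\<close>

lemma linear_dependence:
  fixes v :: "'j \<Rightarrow> 'e \<Rightarrow> 'k::field"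
  assumes "finite E" "finite J" "card E < card J"
  shows "\<exists>\<alpha>. (\<exists>j\<in>J. \<alpha> j \<noteq> 0) \<and> (\<forall>e\<in>E. (\<Sum>j\<in>J. \<alpha> j * v j e) = 0)"
  using assms
proof (induction E arbitrary: J v rule: finite_induct)
  case empty
  then have "J \<noteq> {}" by auto
  then show ?case by (intro exI[of _ "\<lambda>_. 1"]) auto
next
  case (insert e E)
  show ?case
  proof (cases "\<forall>j\<in>J. v j e = 0")
    case True
    have "card E < card J" using insert.hyps insert.prems by simp
    from insert.IH[OF insert.prems(1) this, of v] True show ?thesis by auto
  next
    case False
    then obtain i where i: "i \<in> J" "v i e \<noteq> 0" by blast
    have "card E < card (J - {i})" using insert.hyps insert.prems i by simp
    then obtain \<beta> where \<beta>: "\<exists>j\<in>J - {i}. \<beta> j \<noteq> 0"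
      "\<forall>x\<in>E. (\<Sum>j\<in>J - {i}. \<beta> j * (v j x - v j e / v i e * v i x)) = 0"
      using insert.IH[of "J - {i}" "\<lambda>j x. v j x - v j e / v i e * v i x"] insert.prems by auto
    \<comment> \<open>The coefficient of the pivot \<open>i\<close> is forced by coordinate
      \<open>e\<close>: at \<open>x = e\<close> all summands on the right of \<open>sum_eq\<close>
      vanish, and the other coordinates are covered by the choice of \<open>\<beta>\<close>.\<close>
    define \<alpha> where "\<alpha> j = (if j = i then - (\<Sum>j\<in>J - {i}. \<beta> j * v j e) / v i e else \<beta> j)" for j
    have sum_eq: "(\<Sum>j\<in>J. \<alpha> j * v j x) = (\<Sum>j\<in>J - {i}. \<beta> j * (v j x - v j e / v i e * v i x))" for x
    proof -
      have "(\<Sum>j\<in>J. \<alpha> j * v j x) = \<alpha> i * v i x + (\<Sum>j\<in>J - {i}. \<beta> j * v j x)"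
        using sum.remove[OF insert.prems(1) i(1), of "\<lambda>j. \<alpha> j * v j x"] by (simp add: \<alpha>_def)
      also have "\<dots> = (\<Sum>j\<in>J - {i}. \<beta> j * v j x) - (\<Sum>j\<in>J - {i}. \<beta> j * v j e) / v i e * v i x"
        by (simp add: \<alpha>_def)
      also have "\<dots> = (\<Sum>j\<in>J - {i}. \<beta> j * (v j x - v j e / v i e * v i x))"
        by (simp add: right_diff_distrib sum_subtractf sum_divide_distrib sum_distrib_right mult.assoc)
      finally show ?thesis .
    qed
    show ?thesis
      using \<beta> sum_eq i by (intro exI[of _ \<alpha>]) (auto simp: \<alpha>_def)
  qed
qed

lemma digits_unique:
  fixes f g :: "nat \<Rightarrow> nat"
  assumes "\<And>i. i < n \<Longrightarrow> f i < N" "\<And>i. i < n \<Longrightarrow> g i < N"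
    and "(\<Sum>i<n. f i * N ^ i) = (\<Sum>i<n. g i * N ^ i)" and "i < n"
  shows "f i = g i"
  using assms
proof (induction n arbitrary: f g i)
  case (Suc n)
  have split: "(\<Sum>i<Suc n. h i * N ^ i) = h 0 + N * (\<Sum>i<n. h (Suc i) * N ^ i)" for h :: "nat \<Rightarrow> nat"
    unfolding sum.lessThan_Suc_shift by (simp add: sum_distrib_left ac_simps)
  have eq: "f 0 + N * (\<Sum>i<n. f (Suc i) * N ^ i) = g 0 + N * (\<Sum>i<n. g (Suc i) * N ^ i)"
    using Suc.prems(3) unfolding split .
  have lt: "f 0 < N" "g 0 < N" using Suc.prems(1,2) by auto
  have zero: "f 0 = g 0" using arg_cong[OF eq, of "\<lambda>x. x mod N"] lt by simp
  have "(\<Sum>i<n. f (Suc i) * N ^ i) = (\<Sum>i<n. g (Suc i) * N ^ i)" using eq zero lt by simp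
  then have "f (Suc j) = g (Suc j)" if "j < n" for j
    using Suc.IH[of "\<lambda>i. f (Suc i)" "\<lambda>i. g (Suc i)" j] Suc.prems(1,2) that by simp
  then show ?case using zero Suc.prems(4) by (cases i) auto
qed simp

text \<open>Kronecker substitution \<open>z\<^sub>i = s^(N^i)\<close> reduces to univariate polynomials.\<close>

lemma monomials_independent:
  fixes c :: "(nat \<Rightarrow>\<^sub>0 nat) \<Rightarrow> 'k::field_char_0"
  assumes F: "finite F" "\<And>m. m \<in> F \<Longrightarrow> Poly_Mapping.keys m \<subseteq> {..<n}"
    and zero: "\<And>z. (\<Sum>m\<in>F. c m * (\<Prod>i\<in>Poly_Mapping.keys m. z i ^ Poly_Mapping.lookup m i)) = 0"
    and m: "m \<in> F"
  shows "c m = 0"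
proof -
  \<comment> \<open>One more than every exponent that occurs, so that exponents are digits in base
    \<open>N\<close> and \<open>code\<close> is injective on \<open>F\<close>.\<close>
  define N where "N = Suc (Max ((\<lambda>(m, i). Poly_Mapping.lookup m i) ` (F \<times> {..n})))"
  have N: "Poly_Mapping.lookup m i < N" if "m \<in> F" "i < n" for m i
  proof -
    have "Poly_Mapping.lookup m i \<le> Max ((\<lambda>(m, i). Poly_Mapping.lookup m i) ` (F \<times> {..n}))"
      using that F(1) by (intro Max_ge) force+
    then show ?thesis by (simp add: N_def)
  qed
  define code where "code m = (\<Sum>i<n. Poly_Mapping.lookup m i * N ^ i)" for m
  have inj: "m = m'" if "m \<in> F" "m' \<in> F" "code m = code m'" for m m'
  proof (rule poly_mapping_eqI)
    fix i
    show "Poly_Mapping.lookup m i = Poly_Mapping.lookup m' i"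
    proof (cases "i < n")
      case True
      then show ?thesis
        using that N digits_unique[of n "Poly_Mapping.lookup m" N "Poly_Mapping.lookup m'" i]
        unfolding code_def by blast
    next
      case False
      then have "i \<notin> Poly_Mapping.keys m" "i \<notin> Poly_Mapping.keys m'" using F(2) that by blast+
      then show ?thesis by (simp add: in_keys_iff)
    qed
  qed
  have eval: "(\<Prod>i\<in>Poly_Mapping.keys m. (s ^ (N ^ i)) ^ Poly_Mapping.lookup m i) = s ^ code m"
    if "m \<in> F" for m and s :: 'k
  proof -
    have "(\<Prod>i\<in>Poly_Mapping.keys m. (s ^ (N ^ i)) ^ Poly_Mapping.lookup m i) =
        (\<Prod>i<n. (s ^ (N ^ i)) ^ Poly_Mapping.lookup m i)"
      using F(2)[OF that] by (intro prod.mono_neutral_left) (auto simp: in_keys_iff)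
    then show ?thesis unfolding code_def by (simp add: power_sum mult.commute flip: power_mult)
  qed
  define p where "p = (\<Sum>m\<in>F. Polynomial.monom (c m) (code m))"
  have "poly p s = 0" for s
    using zero[of "\<lambda>i. s ^ (N ^ i)"] eval by (simp add: p_def poly_sum poly_monom)
  then have "p = 0" using poly_all_0_iff_0 by blast
  then have "0 = Polynomial.coeff p (code m)" by simp
  also have "\<dots> = (\<Sum>m'\<in>F. if m' = m then c m else 0)"
    unfolding p_def coeff_sum using inj m by (intro sum.cong refl) auto
  also have "\<dots> = c m" using F(1) m by simp
  finally show ?thesis by simp
qed

section \<open>Linear maps prescribed on monomials\<close>

lemma lookup_scale_poly [simp]:
  "Poly_Mapping.lookup (scale_poly c p) m = c * Poly_Mapping.lookup p m"
proof -
  have "scale_poly c p = Poly_Mapping.map ((*) c) p"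
    by (simp add: scale_poly_def mult_map_scale_conv_mult)
  then show ?thesis by (simp add: Poly_Mapping.map.rep_eq when_def)
qed

lemma scale_poly_single [simp]:
  "scale_poly c (Poly_Mapping.single m d) = Poly_Mapping.single m (c * d)"
  by (simp add: scale_poly_def mult_single)

lemma sum_single_keys:
  fixes p :: "'m \<Rightarrow>\<^sub>0 'k::comm_monoid_add"
  shows "(\<Sum>m\<in>Poly_Mapping.keys p. Poly_Mapping.single m (Poly_Mapping.lookup p m)) = p"
proof (rule poly_mapping_eqI)
  fix x
  show "Poly_Mapping.lookup (\<Sum>m\<in>Poly_Mapping.keys p. Poly_Mapping.single m (Poly_Mapping.lookup p m)) x =
      Poly_Mapping.lookup p x"
    by (auto simp: lookup_sum lookup_single when_def in_keys_iff)
qed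

lemma poly_mapping_induct_keys [consumes 1, case_names zero single add]:
  fixes p :: "'m \<Rightarrow>\<^sub>0 'k::comm_monoid_add"
  assumes keys: "Poly_Mapping.keys p \<subseteq> M"
    and zero: "Q 0"
    and single: "\<And>m c. m \<in> M \<Longrightarrow> Q (Poly_Mapping.single m c)"
    and add: "\<And>p q. Poly_Mapping.keys p \<subseteq> M \<Longrightarrow> Poly_Mapping.keys q \<subseteq> M \<Longrightarrow> Q p \<Longrightarrow> Q q \<Longrightarrow> Q (p + q)"
  shows "Q p"
proof -
  define f where "f = (\<lambda>m. Poly_Mapping.single m (Poly_Mapping.lookup p m))"
  have "Poly_Mapping.keys (sum f F) \<subseteq> M \<and> Q (sum f F)" if "finite F" "F \<subseteq> M" for F
    using that
  proof (induction F)
    case (insert m F)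
    have "Poly_Mapping.keys (f m) \<subseteq> M" "Q (f m)" using insert.prems single by (auto simp: f_def)
    then show ?case
      using insert add[of "f m" "sum f F"] keys_add[of "f m" "sum f F"] by auto
  qed (simp add: zero)
  from this[of "Poly_Mapping.keys p"] show ?thesis
    using keys sum_single_keys[of p] by (simp add: f_def)
qed

text \<open>The shape of a normal form map. The exponent map \<open>r\<close> may identify
  monomials, in which case their contributions are added.\<close>

definition monomial_map ::
    "('m \<Rightarrow> 'm) \<Rightarrow> ('m \<Rightarrow> complex) \<Rightarrow> ('m \<Rightarrow>\<^sub>0 complex) \<Rightarrow> ('m \<Rightarrow>\<^sub>0 complex)" where
  "monomial_map r c p =
     (\<Sum>m\<in>Poly_Mapping.keys p. Poly_Mapping.single (r m) (Poly_Mapping.lookup p m * c m))"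

lemma monomial_map_single [simp]:
  "monomial_map r c (Poly_Mapping.single m d) = Poly_Mapping.single (r m) (d * c m)"
  by (simp add: monomial_map_def)

lemma monomial_map_zero [simp]: "monomial_map r c 0 = 0"
  by (simp add: monomial_map_def)

lemma monomial_map_add: "monomial_map r c (p + q) = monomial_map r c p + monomial_map r c q"
  unfolding monomial_map_def
  by (rule setsum_keys_plus_distrib) (simp_all add: distrib_right single_add)

lemma monomial_map_scale:
  fixes r :: "(nat \<Rightarrow>\<^sub>0 nat) \<Rightarrow> (nat \<Rightarrow>\<^sub>0 nat)"
  shows "monomial_map r c (scale_poly d p) = scale_poly d (monomial_map r c p)"
using subset_UNIV[of "Poly_Mapping.keys p"]
proof (induction p rule: poly_mapping_induct_keys)
  case (add p q)
  then show ?case by (simp add: scale_poly_def distrib_left monomial_map_add)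
qed (auto simp: scale_poly_def mult_single mult.assoc)

lemma monomial_map_uminus: "monomial_map r c (- p) = - monomial_map r c p"
  using monomial_map_add[of r c p "- p"] by (simp add: eq_neg_iff_add_eq_0 add.commute)

lemma monomial_map_diff: "monomial_map r c (p - q) = monomial_map r c p - monomial_map r c q"
  using monomial_map_add[of r c p "- q"] by (simp add: monomial_map_uminus)

lemma monomial_map_sum: "monomial_map r c (sum f F) = (\<Sum>i\<in>F. monomial_map r c (f i))"
  by (induction F rule: infinite_finite_induct) (simp_all add: monomial_map_add)

section \<open>Evaluation of univariate polynomials at a multivariate one\<close>

abbreviation const :: "complex \<Rightarrow> mpoly_c" where
  "const c \<equiv> Poly_Mapping.single 0 c"

definition eval_at :: "mpoly_c \<Rightarrow> complex poly \<Rightarrow> mpoly_c" where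
  "eval_at r f = poly (map_poly const f) r"

lemma eval_at_0 [simp]: "eval_at r 0 = 0"
  by (simp add: eval_at_def)

lemma eval_at_pCons [simp]: "eval_at r (pCons a f) = const a + r * eval_at r f"
  by (simp add: eval_at_def map_poly_pCons)

lemma eval_at_add: "eval_at r (f + g) = eval_at r f + eval_at r g"
proof (induction f arbitrary: g)
  case (pCons a f)
  then show ?case by (cases g) (simp add: single_add algebra_simps)
qed simp

lemma eval_at_smult: "eval_at r (Polynomial.smult c f) = const c * eval_at r f"
  by (induction f) (simp_all add: mult_single algebra_simps)

lemma eval_at_mult: "eval_at r (f * g) = eval_at r f * eval_at r g"
  by (induction f) (simp_all add: eval_at_add eval_at_smult algebra_simps)

lemma eval_at_sum: "eval_at r (sum f F) = (\<Sum>i\<in>F. eval_at r (f i))"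
  by (induction F rule: infinite_finite_induct) (simp_all add: eval_at_add)

lemma eval_at_prod: "eval_at r (prod f F) = (\<Prod>i\<in>F. eval_at r (f i))"
proof (induction F rule: infinite_finite_induct)
qed (simp_all add: eval_at_mult one_pCons)

lemma eval_at_monom: "eval_at r (Polynomial.monom c k) = const c * r ^ k"
  by (induction k) (simp_all add: monom_Suc monom_0 ac_simps)

section \<open>Invariant polynomials\<close>

lemma eval_circle_act:
  assumes "w \<noteq> 0"
  shows "eval_poly p (circle_act a w z) =
    (\<Sum>m\<in>Poly_Mapping.keys p. Poly_Mapping.lookup p m *
       w powi (\<Sum>i\<in>Poly_Mapping.keys m. a i * int (Poly_Mapping.lookup m i)) *
       (\<Prod>i\<in>Poly_Mapping.keys m. z i ^ Poly_Mapping.lookup m i))"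
proof -
  have powi_sum: "w powi (sum f F) = (\<Prod>i\<in>F. w powi f i)" for f :: "nat \<Rightarrow> int" and F
    using assms by (induction F rule: infinite_finite_induct) (auto simp: power_int_add)
  have "(\<Prod>i\<in>Poly_Mapping.keys m. circle_act a w z i ^ Poly_Mapping.lookup m i) =
      w powi (\<Sum>i\<in>Poly_Mapping.keys m. a i * int (Poly_Mapping.lookup m i)) *
      (\<Prod>i\<in>Poly_Mapping.keys m. z i ^ Poly_Mapping.lookup m i)" for m
    by (simp add: powi_sum circle_act_def power_mult_distrib prod.distrib power_int_mult)
  then show ?thesis by (simp add: eval_poly_def mult.assoc)
qed

text \<open>Each monomial is an eigenvector of the action, so by independence of monomials an
  invariant polynomial contains only monomials of weight zero. The single value \<open>w = 2\<close>
  detects this, since an integer power of 2 equals 1 only for exponent zero.\<close>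

lemma invariant_polys_eq:
  "invariant_polys n a = {p. \<forall>m\<in>Poly_Mapping.keys p. Poly_Mapping.keys m \<subseteq> {1..n} \<and>
     (\<Sum>i\<in>Poly_Mapping.keys m. a i * int (Poly_Mapping.lookup m i)) = 0}"
proof (rule equalityI; rule subsetI; (rule CollectI, intro ballI conjI)?)
  fix p m assume p: "p \<in> invariant_polys n a" and m: "m \<in> Poly_Mapping.keys p"
  have keys: "Poly_Mapping.keys m \<subseteq> {1..n}" if "m \<in> Poly_Mapping.keys p" for m
    using that p by (auto simp: invariant_polys_def polys_in_def)
  then show "Poly_Mapping.keys m \<subseteq> {1..n}" using m .
  define wt where "wt m = (\<Sum>i\<in>Poly_Mapping.keys m. a i * int (Poly_Mapping.lookup m i))" for m
  have "(\<Sum>m\<in>Poly_Mapping.keys p. Poly_Mapping.lookup p m * (2 powi wt m - 1) *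
       (\<Prod>i\<in>Poly_Mapping.keys m. z i ^ Poly_Mapping.lookup m i)) = 0" for z
  proof -
    have "eval_poly p (circle_act a 2 z) = eval_poly p z"
      using p by (simp add: invariant_polys_def)
    moreover have "(2 :: complex) \<noteq> 0" by simp
    ultimately show ?thesis
      unfolding eval_circle_act[OF \<open>(2 :: complex) \<noteq> 0\<close>] unfolding eval_poly_def wt_def[symmetric]
      by (simp add: algebra_simps sum_subtractf)
  qed
  then have "Poly_Mapping.lookup p m * (2 powi wt m - 1) = 0"
    using keys m monomials_independent[of "Poly_Mapping.keys p" "Suc n"
        "\<lambda>m. Poly_Mapping.lookup p m * (2 powi wt m - 1)" m]
    by (fastforce simp: subset_eq)
  then have "(2 :: complex) powi wt m = 1" using m by (auto simp: in_keys_iff)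
  then have "cmod (2 powi wt m) = 1" by simp
  then have "(2 :: real) powi wt m = 1" by (simp add: norm_power_int)
  then have "wt m = 0"
    using power_int_strict_increasing[of 0 "wt m" "2::real"] power_int_strict_increasing[of "wt m" 0 "2::real"]
    by (cases "wt m" "0::int" rule: linorder_cases) auto
  then show "(\<Sum>i\<in>Poly_Mapping.keys m. a i * int (Poly_Mapping.lookup m i)) = 0"
    by (simp add: wt_def)
next
  fix p :: mpoly_c
  assume p: "p \<in> {p. \<forall>m\<in>Poly_Mapping.keys p. Poly_Mapping.keys m \<subseteq> {1..n} \<and>
     (\<Sum>i\<in>Poly_Mapping.keys m. a i * int (Poly_Mapping.lookup m i)) = 0}"
  then have "eval_poly p (circle_act a w z) = eval_poly p z" if "w \<noteq> 0" for w z
    unfolding eval_circle_act[OF that] unfolding eval_poly_def by (intro sum.cong refl) auto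
  then show "p \<in> invariant_polys n a" using p by (auto simp: invariant_polys_def polys_in_def)
qed

text \<open>Over the complex numbers an algebraic relation modulo a prime splits into linear
  factors, one of which must lie in \<open>P\<close>. The induction strips one root at a time and
  cannot end at a nonzero constant, because constants are units and
  \<open>1 \<notin> P\<close>.\<close>

lemma eval_at_has_root:
  assumes "f \<noteq> 0" "eval_at r f \<in> P" "1 \<notin> P"
    and ideal: "\<And>c x. x \<in> P \<Longrightarrow> const c * x \<in> P"
    and prime: "\<And>z g. (r - const z) * eval_at r g \<in> P \<Longrightarrow> r - const z \<in> P \<or> eval_at r g \<in> P"
  shows "\<exists>z. r - const z \<in> P"
  using assms(1,2)
proof (induction "Polynomial.degree f" arbitrary: f)
  case 0
  then obtain c where c: "f = [:c:]" by (metis degree_eq_zeroE)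
  then have "const c \<in> P" "c \<noteq> 0" using 0 by auto
  then have "const (inverse c) * const c \<in> P" using ideal by blast
  then show ?case using \<open>c \<noteq> 0\<close> \<open>1 \<notin> P\<close> by (simp add: mult_single)
next
  case (Suc d)
  then have "\<not> constant (poly f)" by (simp add: constant_degree)
  then obtain z where "poly f z = 0" using fundamental_theorem_of_algebra by blast
  then obtain g where g: "f = [:- z, 1:] * g" by (auto simp: poly_eq_0_iff_dvd dvd_def)
  have "g \<noteq> 0" using g Suc.prems by auto
  then have "Polynomial.degree f = Suc (Polynomial.degree g)"
    unfolding g by (subst degree_mult_eq) auto
  then have deg: "d = Polynomial.degree g" using Suc.hyps by simp
  have "eval_at r f = (r - const z) * eval_at r g"
    unfolding g eval_at_mult by (simp add: single_uminus)
  then have "r - const z \<in> P \<or> eval_at r g \<in> P" using Suc.prems prime by simp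
  then show ?case using Suc.hyps(1)[OF deg \<open>g \<noteq> 0\<close>] by blast
qed

lemma noetherian_const: "comm_subring (range const)" "noetherian_ring (ring_on (range const))"
proof -
  show sub: "comm_subring (range const)"
  proof
    show "1 \<in> range const" by (rule range_eqI[of _ _ 1]) simp
  qed (auto simp: mult_single simp flip: single_add single_uminus)
  interpret K: comm_subring "range const" by (rule sub)
  show "noetherian_ring (ring_on (range const))"
  proof (rule K.R.noetherian_ringI)
    fix I assume I: "ideal I (ring_on (range const))"
    have empty: "ideal {0} (ring_on (range const))"
      using K.R.zeroideal by simp
    show "\<exists>X\<subseteq>carrier (ring_on (range const)). finite X \<and> I = Idl\<^bsub>ring_on (range const)\<^esub> X"
    proof (cases "I \<subseteq> {0}")
      case True
      then have "I = Idl\<^bsub>ring_on (range const)\<^esub> {}"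
        using K.idealD(2)[OF I] K.gen_least[OF empty, of "{}"] K.gen_least[OF I, of "{}"]
          K.idealD(2)[OF K.gen_ideal[of "{}"]] by blast
      then show ?thesis by blast
    next
      case False
      then obtain x where x: "x \<in> I" "x \<noteq> 0" by blast
      then obtain c where c: "x = const c" "c \<noteq> 0" using K.idealD(1)[OF I] by force
      have "const (inverse c) * x \<in> I" using K.idealD(4)[OF I] x by blast
      then have one: "1 \<in> I" using c by (simp add: mult_single)
      have "Idl\<^bsub>ring_on (range const)\<^esub> {1} = range const"
        using ideal.one_imp_carrier[OF K.gen_ideal[of "{1}"]] K.gen_incl[of "{1}"] K.one_closed by auto
      moreover have "I = range const" using ideal.one_imp_carrier[OF I] one by simp
      ultimately show ?thesis using K.one_closed by (intro exI[of _ "{1}"]) auto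
    qed
  qed
qed

lemma lookup_le_degree: "Poly_Mapping.lookup m i \<le> monom_degree m"
proof (cases "i \<in> Poly_Mapping.keys m")
  case True
  then show ?thesis unfolding monom_degree_def by (intro member_le_sum) auto
qed (simp add: in_keys_iff)

locale weights =
  fixes n :: nat and a :: "nat \<Rightarrow> int"
  assumes n_pos: "n \<ge> 1"
    and a1_neg: "a 1 < 0"
    and a_pos: "\<And>i. i \<in> {2..n} \<Longrightarrow> a i > 0"
begin

section \<open>Exponents of the invariant monomials\<close>

definition "V = {2..n}"
definition "k = nat (- a 1)"
definition "b i = nat (a i)"
definition "wt f = (\<Sum>i\<in>V. b i * f i)"
text \<open>Extends prescribed exponents on \<open>V\<close> by the exponent of the first variable
  that invariance forces. The division is exact only when \<open>k\<close> divides
  \<open>wt f\<close>, which is the hypothesis of \<open>mk_in_M\<close>.\<close>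

definition "mk f = Poly_Mapping.Abs_poly_mapping
  (\<lambda>i. if i \<in> V then f i else if i = 1 then wt f div k else 0)"
definition "M = {m. Poly_Mapping.keys m \<subseteq> {1..n} \<and>
  k * Poly_Mapping.lookup m 1 = wt (Poly_Mapping.lookup m)}"

abbreviation "A \<equiv> invariant_polys n a"

lemma k_pos: "k > 0" and finite_V [simp]: "finite V" and one_notin_V [simp]: "Suc 0 \<notin> V"
  using a1_neg by (simp_all add: k_def V_def)

lemma lookup_mk:
  "Poly_Mapping.lookup (mk f) i = (if i \<in> V then f i else if i = 1 then wt f div k else 0)"
proof -
  have "finite {i. (if i \<in> V then f i else if i = 1 then wt f div k else 0) \<noteq> 0}"
    by (rule finite_subset[of _ "insert 1 V"]) auto
  then show ?thesis unfolding mk_def by simp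
qed

lemma wt_cong: "(\<And>i. i \<in> V \<Longrightarrow> f i = g i) \<Longrightarrow> wt f = wt g"
  by (simp add: wt_def)

lemma wt_add: "wt (\<lambda>i. f i + g i) = wt f + wt g"
  by (simp add: wt_def distrib_left sum.distrib)

lemma mk_in_M: "k dvd wt f \<Longrightarrow> mk f \<in> M"
proof -
  assume dvd: "k dvd wt f"
  have "Poly_Mapping.keys (mk f) \<subseteq> {1..n}"
    using n_pos by (auto simp: in_keys_iff lookup_mk V_def split: if_splits)
  moreover have "wt (Poly_Mapping.lookup (mk f)) = wt f"
    by (rule wt_cong) (simp add: lookup_mk)
  ultimately show ?thesis using dvd by (simp add: M_def lookup_mk)
qed

lemma M_dvd: "m \<in> M \<Longrightarrow> k dvd wt (Poly_Mapping.lookup m)"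
  unfolding M_def by (metis (mono_tags, lifting) dvd_triv_left mem_Collect_eq)

lemma M_eqI:
  assumes "m \<in> M" "m' \<in> M" "\<And>i. i \<in> V \<Longrightarrow> Poly_Mapping.lookup m i = Poly_Mapping.lookup m' i"
  shows "m = m'"
proof (rule poly_mapping_eqI)
  fix i
  have "wt (Poly_Mapping.lookup m) = wt (Poly_Mapping.lookup m')" using assms(3) by (rule wt_cong)
  then have "k * Poly_Mapping.lookup m 1 = k * Poly_Mapping.lookup m' 1"
    using assms(1,2) by (simp add: M_def)
  then have one: "Poly_Mapping.lookup m 1 = Poly_Mapping.lookup m' 1"
    using k_pos by simp
  show "Poly_Mapping.lookup m i = Poly_Mapping.lookup m' i"
  proof (cases "i \<in> {1..n}")
    case True
    then have "i = 1 \<or> i \<in> V" by (auto simp: V_def)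
    then show ?thesis using one assms(3) by blast
  next
    case False
    then have "i \<notin> Poly_Mapping.keys m" "i \<notin> Poly_Mapping.keys m'"
      using assms(1,2) unfolding M_def by blast+
    then show ?thesis by (simp add: in_keys_iff)
  qed
qed

lemma zero_in_M: "0 \<in> M"
  by (simp add: M_def wt_def)

lemma add_in_M: "m \<in> M \<Longrightarrow> m' \<in> M \<Longrightarrow> m + m' \<in> M"
proof -
  assume m: "m \<in> M" "m' \<in> M"
  have "Poly_Mapping.lookup (m + m') = (\<lambda>i. Poly_Mapping.lookup m i + Poly_Mapping.lookup m' i)"
    by (simp add: fun_eq_iff lookup_add)
  then show ?thesis
    using m keys_add[of m m'] by (auto simp: M_def wt_add distrib_left)
qed

lemma A_eq: "A = {p. Poly_Mapping.keys p \<subseteq> M}"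
proof -
  have "(\<Sum>i\<in>Poly_Mapping.keys m. a i * int (Poly_Mapping.lookup m i)) = 0 \<longleftrightarrow>
      k * Poly_Mapping.lookup m 1 = wt (Poly_Mapping.lookup m)"
    if keys: "Poly_Mapping.keys m \<subseteq> {1..n}" for m
  proof -
    have "(\<Sum>i\<in>Poly_Mapping.keys m. a i * int (Poly_Mapping.lookup m i)) =
        (\<Sum>i\<in>insert 1 V. a i * int (Poly_Mapping.lookup m i))"
      using keys by (intro sum.mono_neutral_left) (auto simp: in_keys_iff V_def)
    also have "\<dots> = a 1 * int (Poly_Mapping.lookup m 1) + (\<Sum>i\<in>V. a i * int (Poly_Mapping.lookup m i))"
      by simp
    also have "(\<Sum>i\<in>V. a i * int (Poly_Mapping.lookup m i)) = int (wt (Poly_Mapping.lookup m))"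
      unfolding wt_def of_nat_sum using a_pos
      by (intro sum.cong refl) (auto simp: b_def V_def order_less_imp_le)
    also have "a 1 * int (Poly_Mapping.lookup m 1) = - int (k * Poly_Mapping.lookup m 1)"
      using a1_neg by (simp add: k_def)
    finally show ?thesis by linarith
  qed
  then show ?thesis unfolding invariant_polys_eq M_def by blast
qed

lemma single_in_A [simp]: "m \<in> M \<Longrightarrow> Poly_Mapping.single m c \<in> A"
  by (simp add: A_eq)

lemma const_in_A [simp]: "const c \<in> A"
  by (simp add: zero_in_M)

sublocale comm_subring A
proof
  show "1 \<in> A" using const_in_A[of 1] by simp
  fix p q assume p: "p \<in> A" and q: "q \<in> A"
  show "p + q \<in> A" using p q keys_add[of p q] by (auto simp: A_eq)
  show "p * q \<in> A" using p q keys_mult[of p q] add_in_M by (fastforce simp: A_eq)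
next
  fix p assume "p \<in> A" then show "- p \<in> A" by (auto simp: A_eq in_keys_iff)
qed

lemma A_induct [consumes 1, case_names zero single add]:
  assumes "p \<in> A" "Q 0" "\<And>m c. m \<in> M \<Longrightarrow> Q (Poly_Mapping.single m c)"
    "\<And>p q. p \<in> A \<Longrightarrow> q \<in> A \<Longrightarrow> Q p \<Longrightarrow> Q q \<Longrightarrow> Q (p + q)"
  shows "Q p"
  using poly_mapping_induct_keys[of p M Q] assms by (simp add: A_eq)

lemma finite_M_bounded: "finite {m \<in> M. \<forall>i\<in>V. Poly_Mapping.lookup m i \<le> B}"
proof (rule finite_subset)
  show "finite (mk ` (PiE V (\<lambda>_. {..B})))" by (intro finite_imageI finite_PiE) auto
  show "{m \<in> M. \<forall>i\<in>V. Poly_Mapping.lookup m i \<le> B} \<subseteq> mk ` (PiE V (\<lambda>_. {..B}))"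
  proof
    fix m assume m: "m \<in> {m \<in> M. \<forall>i\<in>V. Poly_Mapping.lookup m i \<le> B}"
    let ?f = "restrict (Poly_Mapping.lookup m) V"
    have "wt ?f = wt (Poly_Mapping.lookup m)" by (rule wt_cong) simp
    then have "mk ?f = m" using m M_dvd mk_in_M[of ?f] by (intro M_eqI) (auto simp: lookup_mk)
    moreover have "?f \<in> PiE V (\<lambda>_. {..B})" using m by auto
    ultimately show "m \<in> mk ` (PiE V (\<lambda>_. {..B}))" by (metis imageI)
  qed
qed

lemma finite_M_degree: "finite {m \<in> M. monom_degree m \<le> N}"
  by (rule finite_subset[OF _ finite_M_bounded[of N]]) (auto intro: order_trans[OF lookup_le_degree])

section \<open>Splitting off the parameter monomials\<close>

definition "yexp i = mk (\<lambda>j. if j = i then k else 0)"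

definition "y i = (Poly_Mapping.single (yexp i) 1 :: mpoly_c)"

lemma yexp_in_M [simp]: "i \<in> V \<Longrightarrow> yexp i \<in> M"
  unfolding yexp_def by (rule mk_in_M) (auto simp: wt_def intro!: dvd_sum)

lemma y_in_A [simp]: "i \<in> V \<Longrightarrow> y i \<in> A"
  by (simp add: y_def)

lemma lookup_yexp: "i \<in> V \<Longrightarrow> j \<in> V \<Longrightarrow> Poly_Mapping.lookup (yexp i) j = (if j = i then k else 0)"
  by (simp add: yexp_def lookup_mk)

text \<open>Lowering one exponent by \<open>k\<close> keeps the weight divisible by
  \<open>k\<close>. The exponent of the first variable is recomputed from the remaining weight by
  \<open>mk\<close>, so it drops by \<open>b i\<close> of its own accord.\<close>

lemma split_yexp:
  assumes m: "m \<in> M" and i: "i \<in> V" "Poly_Mapping.lookup m i \<ge> k"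
  obtains m' where "m' \<in> M" "m = yexp i + m'"
    "\<And>j. j \<in> V \<Longrightarrow> Poly_Mapping.lookup m j = (if j = i then k else 0) + Poly_Mapping.lookup m' j"
proof -
  define f where "f j = Poly_Mapping.lookup m j - (if j = i then k else 0)" for j
  have "wt (Poly_Mapping.lookup m) = wt (\<lambda>j. (if j = i then k else 0) + f j)"
    using i by (intro wt_cong) (auto simp: f_def)
  also have "\<dots> = wt (\<lambda>j. if j = i then k else 0) + wt f" by (rule wt_add)
  finally have eq: "wt (Poly_Mapping.lookup m) = wt (\<lambda>j. if j = i then k else 0) + wt f" .
  have "k dvd wt (\<lambda>j. if j = i then k else 0)" by (auto simp: wt_def intro!: dvd_sum)
  then have "k dvd wt f" using M_dvd[OF m] eq by (simp add: dvd_add_right_iff)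
  then have f: "mk f \<in> M" by (rule mk_in_M)
  show ?thesis
  proof
    show "mk f \<in> M" by (rule f)
    show *: "Poly_Mapping.lookup m j = (if j = i then k else 0) + Poly_Mapping.lookup (mk f) j"
      if "j \<in> V" for j
      using that i by (simp add: lookup_mk f_def)
    show "m = yexp i + mk f"
      using * i by (intro M_eqI m add_in_M f yexp_in_M) (simp_all add: lookup_add lookup_yexp)
  qed
qed

text \<open>The termination measure for splitting off parameter monomials, and the part of the
  degree that comes from outside the first variable.\<close>

definition "size_V m = (\<Sum>i\<in>V. Poly_Mapping.lookup m i)"

lemma size_V_split:
  assumes "i \<in> V" "\<And>j. j \<in> V \<Longrightarrow> Poly_Mapping.lookup m j = (if j = i then k else 0) + Poly_Mapping.lookup m' j"
  shows "size_V m' < size_V m"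
  unfolding size_V_def
proof (rule sum_strict_mono_ex1)
  show "\<forall>j\<in>V. Poly_Mapping.lookup m' j \<le> Poly_Mapping.lookup m j" using assms by simp
  show "\<exists>j\<in>V. Poly_Mapping.lookup m' j < Poly_Mapping.lookup m j"
    using assms k_pos by (intro bexI[of _ i]) auto
qed simp

text \<open>Invariant monomials with exponents on \<open>V\<close> at most \<open>k\<close> generate
  \<open>A\<close> over the constants, since from a larger exponent a factor \<open>yexp i\<close>
  can be split off. The bound includes \<open>k\<close>, so the \<open>yexp i\<close> are themselves
  among the generators.\<close>

lemma noetherian_A: "noetherian_ring (ring_on A)"
proof (rule noetherian_fin_gen[OF noetherian_const])
  let ?G = "(\<lambda>m. Poly_Mapping.single m 1 :: mpoly_c) ` {m \<in> M. \<forall>i\<in>V. Poly_Mapping.lookup m i \<le> k}"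
  show "finite ?G" using finite_M_bounded by blast
  show "comm_subring A" by (rule comm_subring_axioms)
  show "range const \<subseteq> A" by auto
  show "?G \<subseteq> A" by auto
  fix C assume C: "comm_subring C" "range const \<subseteq> C" "?G \<subseteq> C"
  interpret C: comm_subring C by fact
  have monomial: "m \<in> M \<Longrightarrow> Poly_Mapping.single m 1 \<in> C" for m
  proof (induction "size_V m" arbitrary: m rule: less_induct)
    case less
    show ?case
    proof (cases "\<forall>i\<in>V. Poly_Mapping.lookup m i \<le> k")
      case True
      then show ?thesis using C(3) less.prems by auto
    next
      case False
      then obtain i where i: "i \<in> V" "Poly_Mapping.lookup m i \<ge> k" by force
      obtain m' where m': "m' \<in> M" "m = yexp i + m'"
        "\<And>j. j \<in> V \<Longrightarrow> Poly_Mapping.lookup m j = (if j = i then k else 0) + Poly_Mapping.lookup m' j"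
        by (rule split_yexp[OF less.prems i]) (blast intro: that)
      have "Poly_Mapping.single m' 1 \<in> C" using less.hyps[OF size_V_split[OF i(1) m'(3)] m'(1)] .
      moreover have "Poly_Mapping.single (yexp i) 1 \<in> C"
        using C(3) i(1) by (auto simp: lookup_yexp image_subset_iff)
      ultimately have "Poly_Mapping.single (yexp i) 1 * Poly_Mapping.single m' 1 \<in> C" by simp
      then show ?thesis using m'(2) by (simp add: mult_single)
    qed
  qed
  show "A \<subseteq> C"
  proof
    fix p assume "p \<in> A"
    then show "p \<in> C"
    proof (induction rule: A_induct)
      case (single m c)
      have "const c \<in> C" using C(2) by blast
      then have "const c * Poly_Mapping.single m 1 \<in> C" using monomial[OF single] by (rule C.mult_closed)
      then show ?case by (simp add: mult_single)
    qed simp_all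
  qed
qed

text \<open>Nullstellensatz: if no \<open>r - z\<close> lies in \<open>P\<close>, the inverses of \<open>r - z\<close> modulo \<open>P\<close> form an
  uncountable family in a space of countable dimension, so they are linearly dependent; clearing
  denominators gives an algebraic equation for \<open>r\<close> modulo \<open>P\<close>.\<close>

lemma rational_point:
  assumes P: "maximalideal P (ring_on A)" and r: "r \<in> A"
  shows "\<exists>z. r - const z \<in> P"
proof (rule ccontr)
  assume no_root: "\<nexists>z. r - const z \<in> P"
  interpret P: maximalideal P "ring_on A" by fact
  have P_ideal: "ideal P (ring_on A)" by (rule P.is_ideal)
  have one_notin: "1 \<notin> P" using ideal.one_imp_carrier[OF P_ideal] P.I_notcarr by auto
  have "primeideal P (ring_on A)" using R.maximalideal_prime[OF P] .
  then have prime: "x \<in> A \<Longrightarrow> y \<in> A \<Longrightarrow> x * y \<in> P \<Longrightarrow> x \<in> P \<or> y \<in> P" for x y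
    using primeideal.I_prime[of P "ring_on A" x y] by simp
  \<comment> \<open>By maximality, \<open>P\<close> together with \<open>r - const z\<close>
    generates the unit ideal.\<close>
  have "\<exists>g\<in>A. 1 - (r - const z) * g \<in> P" for z
  proof -
    let ?x = "r - const z"
    have xA: "?x \<in> A" using r by simp
    let ?J = "{p + g * ?x | p g. p \<in> P \<and> g \<in> A}"
    have J_I: "u \<in> ?J" if "p \<in> P" "g \<in> A" "u = p + g * ?x" for u p g
      using that by blast
    have J: "ideal ?J (ring_on A)"
      unfolding ideal_iff
    proof (intro conjI ballI)
      show "?J \<subseteq> A"
      proof safe
        fix p g assume "p \<in> P" "g \<in> A"
        then have "p \<in> A" using idealD(1)[OF P_ideal] by blast
        then show "p + g * ?x \<in> A" using xA \<open>g \<in> A\<close> by (intro add_closed mult_closed)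
      qed
      show "0 \<in> ?J" by (rule J_I[OF idealD(2)[OF P_ideal] zero_closed]) simp
      fix u v assume "u \<in> ?J" "v \<in> ?J"
      then obtain p g p' g' where *: "u = p + g * ?x" "v = p' + g' * ?x" "p \<in> P" "p' \<in> P" "g \<in> A" "g' \<in> A"
        by blast
      show "u + v \<in> ?J"
        by (rule J_I[OF idealD(3)[OF P_ideal *(3,4)] add_closed[OF *(5,6)]])
          (simp add: *(1,2) algebra_simps)
    next
      fix c u assume c: "c \<in> A" and "u \<in> ?J"
      then obtain p g where *: "u = p + g * ?x" "p \<in> P" "g \<in> A" by blast
      show "c * u \<in> ?J"
        by (rule J_I[OF idealD(4)[OF P_ideal c *(2)] mult_closed[OF c *(3)]])
          (simp add: *(1) algebra_simps)
    qed
    have P_sub: "P \<subseteq> ?J"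
    proof
      fix p assume "p \<in> P"
      then show "p \<in> ?J" by (rule J_I[OF _ zero_closed]) simp
    qed
    have x_in: "?x \<in> ?J"
      by (rule J_I[OF idealD(2)[OF P_ideal] one_closed]) simp
    have "?J = P \<or> ?J = A" using P.I_maximal[OF J P_sub] idealD(1)[OF J] by simp
    moreover have "?J \<noteq> P" using x_in no_root by metis
    ultimately have "1 \<in> ?J" using one_closed by simp
    then obtain p g where pg: "1 = p + g * ?x" "p \<in> P" "g \<in> A" by blast
    have "1 - ?x * g = p" by (subst pg(1)) (simp add: mult.commute)
    then show ?thesis using pg(2,3) by blast
  qed
  then obtain g where g: "\<And>z. g z \<in> A" "\<And>z. 1 - (r - const z) * g z \<in> P" by metis
  define bound where "bound p = Max (insert 0 (monom_degree ` Poly_Mapping.keys p))" for p :: mpoly_c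
  have bound: "monom_degree m \<le> bound p" if "m \<in> Poly_Mapping.keys p" for m p
    using that unfolding bound_def by (intro Max_ge) auto
  \<comment> \<open>Pigeonhole: uncountably many \<open>z\<close> share countably many degree
    bounds. Infinitely many inverses therefore lie in the finite-dimensional span of the monomials
    of degree at most \<open>N\<close>, and \<open>card E + 1\<close> of them are dependent.\<close>
  have "\<exists>N. infinite {z. bound (g z) = N}"
  proof (rule ccontr)
    assume "\<nexists>N. infinite {z. bound (g z) = N}"
    then have "countable (\<Union>N. {z. bound (g z) = N})" by (intro countable_UN) (auto intro: countable_finite)
    also have "(\<Union>N. {z. bound (g z) = N}) = (UNIV :: complex set)" by auto
    finally have "countable (complex_of_real ` UNIV)" by (rule countable_subset[rotated]) auto
    then have "countable (UNIV :: real set)" by (rule countable_image_inj_on) (auto simp: inj_on_def)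
    then show False using uncountable_UNIV_real by blast
  qed
  then obtain N where N: "infinite {z. bound (g z) = N}" by blast
  define E where "E = {m \<in> M. monom_degree m \<le> N}"
  have E: "finite E" unfolding E_def by (rule finite_M_degree)
  obtain J where J: "finite J" "card J = Suc (card E)" "J \<subseteq> {z. bound (g z) = N}"
    using infinite_arbitrarily_large[OF N] by blast
  obtain \<alpha> where \<alpha>: "\<exists>z\<in>J. \<alpha> z \<noteq> 0"
    "\<forall>m\<in>E. (\<Sum>z\<in>J. \<alpha> z * Poly_Mapping.lookup (g z) m) = 0"
    using linear_dependence[OF E J(1), of "\<lambda>z. Poly_Mapping.lookup (g z)"] J(2) by auto
  have relation: "(\<Sum>z\<in>J. const (\<alpha> z) * g z) = 0"
  proof (rule poly_mapping_eqI)
    fix m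
    show "Poly_Mapping.lookup (\<Sum>z\<in>J. const (\<alpha> z) * g z) m = Poly_Mapping.lookup 0 m"
    proof (cases "m \<in> E")
      case True
      then show ?thesis using \<alpha>(2) by (simp add: lookup_sum flip: scale_poly_def)
    next
      case False
      have "Poly_Mapping.lookup (g z) m = 0" if "z \<in> J" for z
      proof (rule ccontr)
        assume "Poly_Mapping.lookup (g z) m \<noteq> 0"
        then have m: "m \<in> Poly_Mapping.keys (g z)" by (simp add: in_keys_iff)
        have "bound (g z) = N" using J(3) that by blast
        then have "m \<in> E" using bound[OF m] g(1)[of z] m by (auto simp: E_def A_eq)
        then show False using False by blast
      qed
      then show ?thesis by (simp add: lookup_sum flip: scale_poly_def)
    qed
  qed
  \<comment> \<open>The numerator of the sum of \<open>\<alpha> z / (X - z)\<close> over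
    \<open>J\<close>. At \<open>z0\<close> every summand except its own vanishes, which shows
    \<open>h \<noteq> 0\<close>.\<close>
  define h where "h = (\<Sum>z\<in>J. Polynomial.smult (\<alpha> z) (\<Prod>d\<in>J - {z}. [:- d, 1:]))"
  obtain z0 where z0: "z0 \<in> J" "\<alpha> z0 \<noteq> 0" using \<alpha>(1) by blast
  have "poly h z0 = (\<Sum>z\<in>J. if z = z0 then \<alpha> z0 * (\<Prod>d\<in>J - {z0}. z0 - d) else 0)"
    unfolding h_def poly_sum
  proof (intro sum.cong refl)
    fix z assume "z \<in> J"
    show "poly (Polynomial.smult (\<alpha> z) (\<Prod>d\<in>J - {z}. [:- d, 1:])) z0 =
        (if z = z0 then \<alpha> z0 * (\<Prod>d\<in>J - {z0}. z0 - d) else 0)"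
    proof (cases "z = z0")
      case False
      then have "(\<Prod>d\<in>J - {z}. z0 - d) = 0" using z0(1) J(1) by (intro prod_zero) auto
      then show ?thesis using False by (simp add: poly_prod)
    qed (simp add: poly_prod)
  qed
  also have "\<dots> = \<alpha> z0 * (\<Prod>d\<in>J - {z0}. z0 - d)" using J(1) z0(1) by simp
  also have "\<dots> \<noteq> 0" using z0(2) J(1) by auto
  finally have "h \<noteq> 0" by auto
  have eval_h: "eval_at r h = (\<Sum>z\<in>J. const (\<alpha> z) * (\<Prod>d\<in>J - {z}. r - const d))"
    unfolding h_def by (simp add: eval_at_sum eval_at_smult eval_at_prod single_uminus)
  \<comment> \<open>Subtracting a multiple of the vanishing combination \<open>relation\<close>
    turns each summand into a multiple of \<open>1 - (r - const z) * g z\<close>, which lies in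
    \<open>P\<close>.\<close>
  have "(\<Sum>z\<in>J. const (\<alpha> z) * (\<Prod>d\<in>J - {z}. r - const d)) =
      (\<Sum>z\<in>J. const (\<alpha> z) * (\<Prod>d\<in>J - {z}. r - const d)) -
      (\<Sum>z\<in>J. const (\<alpha> z) * g z) * (\<Prod>d\<in>J. r - const d)"
    by (simp add: relation)
  also have "\<dots> = (\<Sum>z\<in>J. const (\<alpha> z) * (\<Prod>d\<in>J - {z}. r - const d) * (1 - (r - const z) * g z))"
  proof -
    have "const (\<alpha> z) * g z * (\<Prod>d\<in>J. r - const d) =
        const (\<alpha> z) * (\<Prod>d\<in>J - {z}. r - const d) * ((r - const z) * g z)" if "z \<in> J" for z
      using prod.remove[OF J(1) that, of "\<lambda>d. r - const d"] by (simp add: ac_simps)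
    then have "(\<Sum>z\<in>J. const (\<alpha> z) * g z) * (\<Prod>d\<in>J. r - const d) =
        (\<Sum>z\<in>J. const (\<alpha> z) * (\<Prod>d\<in>J - {z}. r - const d) * ((r - const z) * g z))"
      unfolding sum_distrib_right by (rule sum.cong[OF refl])
    moreover have "u * (1 - v) = u - u * v" for u v :: mpoly_c
      by (simp add: right_diff_distrib)
    ultimately show ?thesis by (simp only: sum_subtractf)
  qed
  also have "\<dots> \<in> P"
  proof (rule ideal_sum[OF P_ideal])
    fix z assume "z \<in> J"
    have "const (\<alpha> z) * (\<Prod>d\<in>J - {z}. r - const d) \<in> A"
      using r by (intro mult_closed prod_closed diff_closed const_in_A)
    then show "const (\<alpha> z) * (\<Prod>d\<in>J - {z}. r - const d) * (1 - (r - const z) * g z) \<in> P"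
      using idealD(4)[OF P_ideal] g(2) by blast
  qed
  finally have "eval_at r h \<in> P" by (simp add: eval_h)
  have eval_in_A: "eval_at r f \<in> A" for f using r by (induction f) auto
  have "\<exists>z. r - const z \<in> P"
  proof (rule eval_at_has_root[OF \<open>h \<noteq> 0\<close> \<open>eval_at r h \<in> P\<close> one_notin])
    show "\<And>c x. x \<in> P \<Longrightarrow> const c * x \<in> P" using idealD(4)[OF P_ideal const_in_A] .
    fix z f assume "(r - const z) * eval_at r f \<in> P"
    then show "r - const z \<in> P \<or> eval_at r f \<in> P"
      using prime[of "r - const z" "eval_at r f"] r eval_in_A by simp
  qed
  then show False using no_root by blast
qed

end

section \<open>Parameters and the trace form\<close>

context weights
begin

text \<open>Division of exponents by \<open>k\<close> with remainder: \<open>m\<close> is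
  \<open>red J m\<close> times the powers of \<open>y i\<close>, \<open>i \<in> J\<close>, with
  exponents the quotients, and \<open>coef\<close> is the value of the removed powers at
  \<open>y i = c i\<close>.\<close>

definition "red J m = mk (\<lambda>i. if i \<in> J then Poly_Mapping.lookup m i mod k else Poly_Mapping.lookup m i)"

definition coef :: "(nat \<Rightarrow> complex) \<Rightarrow> nat set \<Rightarrow> (nat \<Rightarrow>\<^sub>0 nat) \<Rightarrow> complex" where
  "coef c J m = (\<Prod>i\<in>J. c i ^ (Poly_Mapping.lookup m i div k))"

text \<open>The normal form modulo the ideal generated by \<open>y i - c i\<close> for \<open>i \<in> J\<close>.\<close>

definition "nf c J = monomial_map (red J) (coef c J)"

definition "pars c J = (\<lambda>i. y i - const (c i)) ` J"

lemma red_in_M: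
  assumes "m \<in> M" "J \<subseteq> V"
  shows "red J m \<in> M"
  unfolding red_def
proof (rule mk_in_M)
  let ?f = "\<lambda>i. if i \<in> J then Poly_Mapping.lookup m i mod k else Poly_Mapping.lookup m i"
  let ?g = "\<lambda>i. if i \<in> J then k * (Poly_Mapping.lookup m i div k) else 0"
  have "wt (Poly_Mapping.lookup m) = wt (\<lambda>i. ?f i + ?g i)" by (rule wt_cong) simp
  then have "wt (Poly_Mapping.lookup m) = wt ?f + wt ?g" by (simp only: wt_add)
  moreover have "k dvd wt ?g" by (auto simp: wt_def intro!: dvd_sum)
  ultimately show "k dvd wt ?f" using M_dvd[OF assms(1)] by (simp add: dvd_add_left_iff)
qed

lemma lookup_red:
  "i \<in> V \<Longrightarrow> Poly_Mapping.lookup (red J m) i =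
     (if i \<in> J then Poly_Mapping.lookup m i mod k else Poly_Mapping.lookup m i)"
  by (simp add: red_def lookup_mk)

lemma red_y:
  assumes "m \<in> M" "J \<subseteq> V" "i \<in> V"
  shows "red J (yexp i + m) = (if i \<in> J then red J m else yexp i + red J m)"
  using assms
  by (intro M_eqI) (auto simp: red_in_M add_in_M lookup_red lookup_add lookup_yexp)

lemma coef_y:
  assumes "m \<in> M" "J \<subseteq> V" "i \<in> V"
  shows "coef c J (yexp i + m) = (if i \<in> J then c i else 1) * coef c J m"
proof -
  have "finite J" using assms(2) finite_V finite_subset by blast
  have "coef c J (yexp i + m) = (\<Prod>j\<in>J. (if j = i then c i else 1) * c j ^ (Poly_Mapping.lookup m j div k))"
    unfolding coef_def using assms k_pos
    by (intro prod.cong refl) (auto simp: lookup_add lookup_yexp subset_eq)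
  then show ?thesis using \<open>finite J\<close> by (simp add: prod.distrib coef_def)
qed

lemma nf_add: "nf c J (p + q) = nf c J p + nf c J q"
  and nf_diff: "nf c J (p - q) = nf c J p - nf c J q"
  and nf_sum: "nf c J (sum f F) = (\<Sum>i\<in>F. nf c J (f i))"
  and nf_zero: "nf c J 0 = 0"
  and nf_const: "nf c J (const d * p) = const d * nf c J p"
  using monomial_map_scale[of "red J" "coef c J" d p]
  by (simp_all add: nf_def monomial_map_add monomial_map_diff monomial_map_sum scale_poly_def)

lemma nf_scale: "nf c J (scale_poly d p) = scale_poly d (nf c J p)"
  by (simp add: nf_def monomial_map_scale)

lemma nf_single: "nf c J (Poly_Mapping.single m d) = Poly_Mapping.single (red J m) (d * coef c J m)"
  by (simp add: nf_def)

lemma nf_in_A: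
  assumes "p \<in> A" "J \<subseteq> V"
  shows "nf c J p \<in> A"
  using assms(1) by (induction rule: A_induct) (simp_all add: nf_zero nf_add nf_single red_in_M assms(2))

text \<open>Linearity over the polynomial ring in the \<open>y i\<close>, with \<open>y i\<close>
  specialized to \<open>c i\<close> for \<open>i \<in> J\<close>. This is the form in which the
  freeness of \<open>A\<close> over that ring enters.\<close>

lemma nf_y:
  assumes "p \<in> A" "J \<subseteq> V" "i \<in> V"
  shows "nf c J (y i * p) = (if i \<in> J then const (c i) else y i) * nf c J p"
  using assms(1)
proof (induction rule: A_induct)
  case (single m d)
  then show ?case
    using assms(2,3) by (simp add: y_def mult_single nf_single red_y coef_y mult.left_commute)
qed (simp_all add: nf_zero nf_add distrib_left)

lemma pars_in_A: "J \<subseteq> V \<Longrightarrow> pars c J \<subseteq> A"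
  by (auto simp: pars_def subset_eq)

lemma nf_kills:
  assumes "i \<in> J" "J \<subseteq> V" "r \<in> A"
  shows "nf c J (r * (y i - const (c i))) = 0"
proof -
  have "r * (y i - const (c i)) = y i * r - const (c i) * r" by (simp add: algebra_simps)
  then show ?thesis using assms nf_y[of r J i c] by (auto simp: nf_diff nf_const)
qed

text \<open>For a monomial, one factor \<open>y i\<close> at a time is replaced by
  \<open>c i\<close>; each replacement changes the polynomial by a multiple of a parameter and
  lowers \<open>size_V\<close>.\<close>

lemma nf_congruent:
  assumes "p \<in> A" and J: "J \<subseteq> V"
  shows "p - nf c J p \<in> Idl\<^bsub>ring_on A\<^esub> (pars c J)" (is "_ \<in> ?I")
  using assms(1)
proof (induction rule: A_induct)
  have I: "ideal ?I (ring_on A)" by (rule gen_ideal[OF pars_in_A[OF J]])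
  case zero
  then show ?case using idealD(2)[OF I] by (simp add: nf_zero)
next
  have I: "ideal ?I (ring_on A)" by (rule gen_ideal[OF pars_in_A[OF J]])
  case (add p q)
  then show ?case using idealD(3)[OF I] by (simp add: nf_add add_diff_add)
next
  have I: "ideal ?I (ring_on A)" by (rule gen_ideal[OF pars_in_A[OF J]])
  case (single m d)
  then show ?case
  proof (induction "size_V m" arbitrary: m rule: less_induct)
    case less
    let ?s = "\<lambda>m. Poly_Mapping.single m d"
    show ?case
    proof (cases "\<forall>i\<in>J. Poly_Mapping.lookup m i < k")
      case True
      then have "red J m = m"
        using less.prems J by (intro M_eqI red_in_M) (auto simp: lookup_red)
      moreover have "coef c J m = 1" using True by (simp add: coef_def)
      ultimately show ?thesis using idealD(2)[OF I] by (simp add: nf_single)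
    next
      case False
      then obtain i where i: "i \<in> J" "k \<le> Poly_Mapping.lookup m i" by force
      have iV: "i \<in> V" using i J by blast
      obtain m' where m': "m' \<in> M" "m = yexp i + m'"
        "\<And>j. j \<in> V \<Longrightarrow> Poly_Mapping.lookup m j = (if j = i then k else 0) + Poly_Mapping.lookup m' j"
        by (rule split_yexp[OF less.prems iV i(2)]) (blast intro: that)
      have s: "?s m = y i * ?s m'" by (simp add: y_def mult_single m'(2))
      have "nf c J (?s m) = const (c i) * nf c J (?s m')"
        unfolding s using nf_y[of "?s m'" J i c] m'(1) J iV i(1) by simp
      then have eq: "?s m - nf c J (?s m) =
          ?s m' * (y i - const (c i)) + const (c i) * (?s m' - nf c J (?s m'))"
        using s by (simp add: algebra_simps)
      have "y i - const (c i) \<in> ?I"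
        using gen_incl[OF pars_in_A[OF J]] i(1) unfolding pars_def by blast
      then have 1: "?s m' * (y i - const (c i)) \<in> ?I"
        using idealD(4)[OF I single_in_A[OF m'(1)]] by blast
      have "?s m' - nf c J (?s m') \<in> ?I"
        using less.hyps[OF size_V_split[OF iV m'(3)] m'(1)] .
      then have 2: "const (c i) * (?s m' - nf c J (?s m')) \<in> ?I"
        by (rule idealD(4)[OF I const_in_A])
      show ?thesis unfolding eq by (rule idealD(3)[OF I 1 2])
    qed
  qed
qed

text \<open>The map \<open>nf\<close> is not multiplicative, so its kernel is not visibly an ideal.
  The set \<open>?K\<close> of elements all of whose multiples are killed is one, and it contains
  the parameters.\<close>

lemma nf_mult_ideal:
  assumes J: "J \<subseteq> V" and p: "p \<in> Idl\<^bsub>ring_on A\<^esub> (pars c J)" and r: "r \<in> A"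
  shows "nf c J (r * p) = 0"
proof -
  let ?K = "{p \<in> A. \<forall>r\<in>A. nf c J (r * p) = 0}"
  have "ideal ?K (ring_on A)"
    unfolding ideal_iff
  proof (intro conjI ballI)
    show "0 \<in> ?K" by (simp add: nf_zero)
    fix u v assume "u \<in> ?K" "v \<in> ?K"
    then show "u + v \<in> ?K" by (simp add: distrib_left nf_add)
  next
    fix u v assume uv: "u \<in> A" "v \<in> ?K"
    have "nf c J (w * (u * v)) = 0" if "w \<in> A" for w
      using uv that mult_closed[of w u] by (simp flip: mult.assoc)
    then show "u * v \<in> ?K" using uv by simp
  qed auto
  moreover have "pars c J \<subseteq> ?K"
    using nf_kills[OF _ J] pars_in_A[OF J, of c] unfolding pars_def by auto
  ultimately have "Idl\<^bsub>ring_on A\<^esub> (pars c J) \<subseteq> ?K" by (rule gen_least)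
  then show ?thesis using p r by blast
qed

lemma mem_ideal_iff:
  assumes "p \<in> A" "J \<subseteq> V"
  shows "p \<in> Idl\<^bsub>ring_on A\<^esub> (pars c J) \<longleftrightarrow> nf c J p = 0"
  using nf_mult_ideal[OF assms(2) _ one_closed, of p c] nf_congruent[OF assms, of c] by auto

lemma nf_mult_nf:
  assumes "p \<in> A" "r \<in> A" "J \<subseteq> V"
  shows "nf c J (r * nf c J p) = nf c J (r * p)"
  using nf_mult_ideal[OF assms(3) nf_congruent[OF assms(1,3)] assms(2), of c]
  by (simp add: right_diff_distrib nf_diff)

text \<open>For \<open>i \<notin> J\<close> the projection \<open>nf c J\<close> commutes with
  multiplication by \<open>y i - const (c i)\<close>. This factor is nonzero and the polynomials
  form a domain, so \<open>nf c J r\<close> vanishes.\<close>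

lemma pars_regular:
  assumes J: "J \<subseteq> V" and i: "i \<in> V" "i \<notin> J" and r: "r \<in> A"
    and mem: "(y i - const (c i)) * r \<in> Idl\<^bsub>ring_on A\<^esub> (pars c J)"
  shows "r \<in> Idl\<^bsub>ring_on A\<^esub> (pars c J)"
proof -
  have "nf c J ((y i - const (c i)) * r) = (y i - const (c i)) * nf c J r"
    unfolding left_diff_distrib nf_diff nf_const using nf_y[OF r J i(1), of c] i(2) by simp
  moreover have "nf c J ((y i - const (c i)) * r) = 0"
    using mem mem_ideal_iff[OF _ J, of "(y i - const (c i)) * r" c] r i(1) by simp
  moreover have "y i - const (c i) \<noteq> 0"
  proof
    assume "y i - const (c i) = 0"
    then have "Poly_Mapping.lookup (y i) (yexp i) = Poly_Mapping.lookup (const (c i)) (yexp i)" by simp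
    then have "yexp i = 0" by (auto simp: y_def lookup_single when_def split: if_splits)
    then show False using lookup_yexp[OF i(1) i(1)] k_pos by simp
  qed
  ultimately show ?thesis using mem_ideal_iff[OF r J] by simp
qed

lemma keys_nf:
  assumes "p \<in> A"
  shows "Poly_Mapping.keys (nf c V p) \<subseteq> {m \<in> M. \<forall>i\<in>V. Poly_Mapping.lookup m i < k}"
  using assms
proof (induction rule: A_induct)
  case (single m d)
  then show ?case using k_pos by (auto simp: nf_single red_in_M lookup_red)
next
  case (add p q)
  then show ?case using keys_add[of "nf c V p" "nf c V q"] by (auto simp: nf_add)
qed (simp add: nf_zero)

lemma finite_residues: "finite {m \<in> M. \<forall>i\<in>V. Poly_Mapping.lookup m i < k}"
  by (rule finite_subset[OF _ finite_M_bounded[of k]]) auto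

text \<open>Normal forms modulo all parameters are supported on the finite set \<open>?E\<close>, so
  those of the \<open>card ?E + 1\<close> powers of \<open>r\<close> with exponents up to
  \<open>card ?E\<close> are linearly dependent.\<close>

lemma algebraic_mod_pars:
  assumes r: "r \<in> A"
  shows "\<exists>f. f \<noteq> 0 \<and> eval_at r f \<in> Idl\<^bsub>ring_on A\<^esub> (pars c V)"
proof -
  let ?E = "{m \<in> M. \<forall>i\<in>V. Poly_Mapping.lookup m i < k}"
  obtain \<alpha> where \<alpha>: "\<exists>j\<in>{..card ?E}. \<alpha> j \<noteq> 0"
    "\<forall>m\<in>?E. (\<Sum>j\<le>card ?E. \<alpha> j * Poly_Mapping.lookup (nf c V (r ^ j)) m) = 0"
    using linear_dependence[OF finite_residues, of "{..card ?E}" "\<lambda>j. Poly_Mapping.lookup (nf c V (r ^ j))"]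
    by auto
  define f where "f = (\<Sum>j\<le>card ?E. Polynomial.monom (\<alpha> j) j)"
  have "f \<noteq> 0"
  proof -
    obtain i where i: "i \<le> card ?E" "\<alpha> i \<noteq> 0" using \<alpha>(1) by auto
    then have "Polynomial.coeff f i = \<alpha> i" by (simp add: f_def coeff_sum)
    then show ?thesis using i(2) by auto
  qed
  have f: "eval_at r f = (\<Sum>j\<le>card ?E. const (\<alpha> j) * r ^ j)"
    by (simp add: f_def eval_at_sum eval_at_monom)
  have "nf c V (eval_at r f) = 0"
  proof (rule poly_mapping_eqI)
    fix m
    have "Poly_Mapping.lookup (nf c V (r ^ j)) m = 0" if "m \<notin> ?E" for j
    proof -
      have "m \<notin> Poly_Mapping.keys (nf c V (r ^ j))"
        using keys_nf[OF power_closed[OF r], of c j] that by blast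
      then show ?thesis by (simp add: in_keys_iff)
    qed
    moreover have "Poly_Mapping.lookup (nf c V (eval_at r f)) m =
        (\<Sum>j\<le>card ?E. \<alpha> j * Poly_Mapping.lookup (nf c V (r ^ j)) m)"
      by (simp add: f nf_sum nf_scale lookup_sum flip: scale_poly_def)
    ultimately show "Poly_Mapping.lookup (nf c V (eval_at r f)) m = Poly_Mapping.lookup 0 m"
      using \<alpha>(2) by (cases "m \<in> ?E") simp_all
  qed
  moreover have "eval_at r f \<in> A" unfolding f using r by (intro sum_closed mult_closed power_closed const_in_A)
  ultimately show ?thesis using \<open>f \<noteq> 0\<close> mem_ideal_iff[of "eval_at r f" V c] by blast
qed

text \<open>Since \<open>mk\<close> rounds down, this is an invariant monomial exactly when
  \<open>k\<close> divides \<open>(k - 1) * sum b V\<close>; as \<open>k\<close> and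
  \<open>k - 1\<close> are coprime, this amounts to \<open>k\<close> dividing
  \<open>sum b V\<close>.\<close>

definition "top_exp = mk (\<lambda>_. k - 1)"

text \<open>Modulo the parameters, \<open>A\<close> has the basis of monomials with exponents below \<open>k\<close>, and the
  monomial \<open>top_exp - e\<close> is dual to \<open>e\<close> for the pairing \<open>(p, q) \<mapsto> trace (p q)\<close>, whatever \<open>c\<close> is.\<close>

definition "trace c p = Poly_Mapping.lookup (nf c V p) top_exp"

lemma trace_diff: "trace c (p - q) = trace c p - trace c q"
  by (simp add: trace_def nf_diff lookup_minus)

lemma trace_const: "trace c (const d * p) = d * trace c p"
  unfolding trace_def nf_const by (simp flip: scale_poly_def)

lemma trace_ideal: "p \<in> Idl\<^bsub>ring_on A\<^esub> (pars c V) \<Longrightarrow> trace c p = 0"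
  using nf_mult_ideal[of V p c 1] by (simp add: trace_def)

end

section \<open>Nondegeneracy of the trace form and the Gorenstein property\<close>

locale gorenstein_weights = weights +
  assumes dvd_sum: "a 1 dvd (\<Sum>j = 2..n. a j)"
begin

lemma k_dvd: "k dvd sum b V"
proof -
  have "int (sum b V) = (\<Sum>j = 2..n. a j)"
    unfolding of_nat_sum V_def using a_pos by (intro sum.cong refl) (auto simp: b_def order_less_imp_le)
  moreover have "int k = - a 1" using a1_neg by (simp add: k_def)
  ultimately have "int k dvd int (sum b V)" using dvd_sum by simp
  then show ?thesis by (simp only: int_dvd_int_iff)
qed

lemma wt_top: "k dvd wt (\<lambda>_. k - 1)"
  unfolding wt_def sum_distrib_right[symmetric] using k_dvd by simp

lemma top_in_M: "top_exp \<in> M"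
  unfolding top_exp_def by (rule mk_in_M[OF wt_top])

text \<open>Pairing the normal form \<open>q\<close> with the complement \<open>mk f\<close> of
  \<open>e\<close> reads off the coefficient of \<open>q\<close> at \<open>e\<close>: for another
  reduced monomial \<open>m\<close>, some exponent of the product is not congruent to
  \<open>k - 1\<close> modulo \<open>k\<close>.\<close>

lemma trace_nondegenerate:
  assumes p: "p \<in> A" and zero: "\<And>r. r \<in> A \<Longrightarrow> trace c (p * r) = 0"
  shows "p \<in> Idl\<^bsub>ring_on A\<^esub> (pars c V)"
proof -
  define q where "q = nf c V p"
  have q: "q \<in> A" unfolding q_def by (rule nf_in_A[OF p]) simp
  have keys_q: "m \<in> M" "\<And>i. i \<in> V \<Longrightarrow> Poly_Mapping.lookup m i < k" if "m \<in> Poly_Mapping.keys q" for m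
    using keys_nf[OF p, of c] that unfolding q_def by blast+
  have "Poly_Mapping.lookup q e = 0" if e: "e \<in> Poly_Mapping.keys q" for e
  proof -
    define f where "f i = k - 1 - Poly_Mapping.lookup e i" for i
    have "wt (\<lambda>_. k - 1) = wt (\<lambda>i. Poly_Mapping.lookup e i + f i)"
      using keys_q(2)[OF e] by (intro wt_cong) (fastforce simp: f_def)
    also have "\<dots> = wt (Poly_Mapping.lookup e) + wt f" by (rule wt_add)
    finally have "k dvd wt f" using wt_top M_dvd[OF keys_q(1)[OF e]] by (simp add: dvd_add_right_iff)
    then have f: "mk f \<in> M" by (rule mk_in_M)
    have pair: "trace c (Poly_Mapping.single m d * Poly_Mapping.single (mk f) 1) = (if m = e then d else 0)"
      if m: "m \<in> Poly_Mapping.keys q" for m d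
    proof -
      have red_iff: "red V (m + mk f) = top_exp \<longleftrightarrow> m = e"
      proof
        assume "m = e"
        then show "red V (m + mk f) = top_exp"
          using e keys_q f top_in_M k_pos
          by (intro M_eqI red_in_M add_in_M) (fastforce simp: lookup_red lookup_add lookup_mk top_exp_def f_def)+
      next
        assume eq: "red V (m + mk f) = top_exp"
        show "m = e"
        proof (rule M_eqI[OF keys_q(1)[OF m] keys_q(1)[OF e]])
          fix i assume i: "i \<in> V"
          let ?u = "Poly_Mapping.lookup m i" and ?v = "Poly_Mapping.lookup e i"
          have lt: "?u < k" "?v < k" using keys_q(2) m e i by auto
          have "(?u + (k - 1 - ?v)) mod k = k - 1"
            using arg_cong[OF eq, of "\<lambda>m. Poly_Mapping.lookup m i"] i
            by (simp add: lookup_red lookup_add lookup_mk top_exp_def f_def)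
          then show "?u = ?v"
            using lt by (cases "?u + (k - 1 - ?v) < k") (auto simp: mod_if split: if_splits)
        qed
      qed
      \<comment> \<open>The exponents add up to exactly \<open>k - 1\<close>, so nothing is carried
        and no \<open>c i\<close> appears.\<close>
      have "coef c V (e + mk f) = 1"
        unfolding coef_def using keys_q(2)[OF e]
        by (intro prod.neutral) (fastforce simp: lookup_add lookup_mk f_def)
      then show ?thesis
        using red_iff by (auto simp: trace_def mult_single nf_single lookup_single when_def)
    qed
    have "0 = trace c (p * Poly_Mapping.single (mk f) 1)" using zero f by simp
    also have "\<dots> = trace c (Poly_Mapping.single (mk f) 1 * q)"
      unfolding trace_def q_def using f by (subst nf_mult_nf[OF p]) (simp_all add: mult.commute)
    also have "\<dots> = (\<Sum>m\<in>Poly_Mapping.keys q. trace c (Poly_Mapping.single m (Poly_Mapping.lookup q m) * Poly_Mapping.single (mk f) 1))"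
      unfolding trace_def lookup_sum[symmetric] nf_sum[symmetric] sum_distrib_right[symmetric] sum_single_keys
      by (simp add: mult.commute)
    also have "\<dots> = (\<Sum>m\<in>Poly_Mapping.keys q. if m = e then Poly_Mapping.lookup q e else 0)"
      using pair by (intro sum.cong refl) auto
    also have "\<dots> = Poly_Mapping.lookup q e" using e by simp
    finally show ?thesis by simp
  qed
  then have "q = 0" by (metis in_keys_iff poly_mapping_eqI lookup_zero)
  then show ?thesis using mem_ideal_iff[OF p, of V c] by (simp add: q_def)
qed

theorem gorenstein_A: "gorenstein_ring (ring_on A)"
  unfolding gorenstein_ring_def
proof (intro conjI allI impI)
  show "cring (ring_on A)" by (rule cring)
  show "noetherian_ring (ring_on A)" by (rule noetherian_A)
  fix P assume P: "maximalideal P (ring_on A)"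
  interpret P: maximalideal P "ring_on A" by fact
  have "primeideal P (ring_on A)" using R.maximalideal_prime[OF P] .
  then have prime: "x \<in> A \<Longrightarrow> z \<in> A \<Longrightarrow> x * z \<in> P \<Longrightarrow> x \<in> P \<or> z \<in> P" for x z
    using primeideal.I_prime[of P "ring_on A" x z] by simp
  interpret prime_of_subring A P
  proof
    show "1 \<notin> P" using ideal.one_imp_carrier[OF P.is_ideal] P.I_notcarr by auto
  qed (rule prime)
  have "\<forall>i\<in>V. \<exists>z. y i - const z \<in> P"
    using rational_point[OF P] by simp
  then obtain c where c: "\<And>i. i \<in> V \<Longrightarrow> y i - const (c i) \<in> P" by metis
  \<comment> \<open>The parameters are listed by increasing index from 2. The initial segment of
    length \<open>i\<close> belongs to \<open>J = {2..<2 + i}\<close> and the next parameter has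
    index \<open>2 + i\<close>, outside \<open>J\<close>, as \<open>pars_regular\<close>
    requires.\<close>
  define xs where "xs = map (\<lambda>i. y i - const (c i)) [2..<Suc n]"
  have set_xs: "set xs = pars c V" by (auto simp: xs_def pars_def V_def)
  have take_xs: "set (take i xs) = pars c {2..<2 + i}" if "i < length xs" for i
    using that by (simp add: xs_def pars_def take_map del: upt_Suc)
  show "gorenstein_local_ring (localization (ring_on A) P)"
  proof (rule gorenstein_of_frobenius[where emb = const and lam = "trace c" and xs = xs, OF noetherian_A])
    show "set xs \<subseteq> P" unfolding set_xs using c by (auto simp: pars_def)
    show "r \<in> Idl\<^bsub>ring_on A\<^esub> set (take i xs)"
      if i: "i < length xs" and r: "r \<in> A" and mem: "xs ! i * r \<in> Idl\<^bsub>ring_on A\<^esub> set (take i xs)" for i r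
    proof -
      have "xs ! i = y (2 + i) - const (c (2 + i))" using i by (simp add: xs_def del: upt_Suc)
      moreover have "{2..<2 + i} \<subseteq> V" "2 + i \<in> V" using i by (auto simp: xs_def V_def simp del: upt_Suc)
      ultimately show ?thesis
        using pars_regular[of "{2..<2 + i}" "2 + i" r c] r mem unfolding take_xs[OF i] by simp
    qed
    show "\<exists>f. f \<noteq> 0 \<and> poly (map_poly const f) r \<in> Idl\<^bsub>ring_on A\<^esub> set xs" if "r \<in> A" for r
      using algebraic_mod_pars[OF that] unfolding set_xs eval_at_def .
    show "r \<in> A \<Longrightarrow> \<exists>d. r - const d \<in> P" for r by (rule rational_point[OF P])
    show "trace c x = 0" if "x \<in> Idl\<^bsub>ring_on A\<^esub> set xs" for x
      using trace_ideal that unfolding set_xs by blast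
    show "x \<in> Idl\<^bsub>ring_on A\<^esub> set xs" if "x \<in> A" "\<And>r. r \<in> A \<Longrightarrow> trace c (x * r) = 0" for x
      using trace_nondegenerate[OF that] unfolding set_xs .
  qed (simp_all add: mult_single trace_diff trace_const)
qed

end

section \<open>Hilbert series\<close>

lemma monom_degree_add: "monom_degree (m + m') = monom_degree m + monom_degree m'"
proof -
  have *: "monom_degree m'' = (\<Sum>i\<in>F. Poly_Mapping.lookup m'' i)"
    if "finite F" "Poly_Mapping.keys m'' \<subseteq> F" for F m''
    unfolding monom_degree_def using that by (intro sum.mono_neutral_left) (auto simp: in_keys_iff)
  let ?F = "Poly_Mapping.keys m \<union> Poly_Mapping.keys m'"
  have "monom_degree (m + m') = (\<Sum>i\<in>?F. Poly_Mapping.lookup (m + m') i)"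
    using keys_add[of m m'] by (intro *) simp_all
  also have "\<dots> = monom_degree m + monom_degree m'"
    using *[of ?F m] *[of ?F m'] by (simp add: lookup_add sum.distrib)
  finally show ?thesis .
qed

lemma dim_homogeneous_part:
  assumes "finite {m \<in> M. monom_degree m = d}"
  shows "vector_space.dim scale_poly (homogeneous_part {p. Poly_Mapping.keys p \<subseteq> M} d) =
    card {m \<in> M. monom_degree m = d}" (is "_ = card ?D")
proof -
  interpret vector_space scale_poly by (rule vector_space_scale_poly)
  let ?e = "\<lambda>m. Poly_Mapping.single m (1 :: complex)"
  have inj: "inj_on ?e ?D"
  proof (rule inj_onI)
    fix m m' assume "?e m = ?e m'"
    then have "Poly_Mapping.keys (?e m) = Poly_Mapping.keys (?e m')" by simp
    then show "m = m'" by simp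
  qed
  show ?thesis
  proof (rule dim_unique)
    show "?e ` ?D \<subseteq> homogeneous_part {p. Poly_Mapping.keys p \<subseteq> M} d"
      by (auto simp: homogeneous_part_def)
    show "homogeneous_part {p. Poly_Mapping.keys p \<subseteq> M} d \<subseteq> span (?e ` ?D)"
    proof
      fix p assume "p \<in> homogeneous_part {p. Poly_Mapping.keys p \<subseteq> M} d"
      then have keys: "Poly_Mapping.keys p \<subseteq> ?D" by (auto simp: homogeneous_part_def)
      have "(\<Sum>m\<in>Poly_Mapping.keys p. scale_poly (Poly_Mapping.lookup p m) (?e m)) \<in> span (?e ` ?D)"
        using keys by (intro span_sum span_scale span_base) auto
      then show "p \<in> span (?e ` ?D)" using sum_single_keys[of p] by simp
    qed
    show "independent (?e ` ?D)"
    proof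
      assume "dependent (?e ` ?D)"
      then obtain u where u: "\<exists>v\<in>?e ` ?D. u v \<noteq> 0" "(\<Sum>v\<in>?e ` ?D. scale_poly (u v) v) = 0"
        using dependent_finite[of "?e ` ?D"] assms by auto
      then obtain m where m: "m \<in> ?D" "u (?e m) \<noteq> 0" by auto
      have "0 = Poly_Mapping.lookup (\<Sum>v\<in>?e ` ?D. scale_poly (u v) v) m" using u(2) by simp
      also have "(\<Sum>v\<in>?e ` ?D. scale_poly (u v) v) = (\<Sum>m'\<in>?D. Poly_Mapping.single m' (u (?e m')))"
        by (subst sum.reindex[OF inj]) simp
      also have "Poly_Mapping.lookup \<dots> m = (\<Sum>m'\<in>?D. if m' = m then u (?e m) else 0)"
        unfolding lookup_sum by (intro sum.cong refl) (auto simp: lookup_single when_def)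
      also have "\<dots> = u (?e m)" using assms m(1) by simp
      finally show False using m(2) by simp
    qed
    show "card (?e ` ?D) = card ?D" by (rule card_image[OF inj])
  qed
qed

section \<open>Counting invariant monomials by degree\<close>

context weights
begin

lemma monom_degree_M:
  assumes "m \<in> M"
  shows "monom_degree m = Poly_Mapping.lookup m 1 + size_V m"
proof -
  have "monom_degree m = (\<Sum>i\<in>insert 1 V. Poly_Mapping.lookup m i)"
    unfolding monom_degree_def
  proof (rule sum.mono_neutral_left)
    show "Poly_Mapping.keys m \<subseteq> insert 1 V" using assms by (fastforce simp: M_def V_def)
  qed (auto simp: in_keys_iff)
  then show ?thesis by (simp add: size_V_def)
qed

lemma monom_degree_yexp:
  assumes "i \<in> V"
  shows "monom_degree (yexp i) = k + b i"
proof -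
  have "wt (\<lambda>j. if j = i then k else 0) = b i * k"
    using assms by (simp add: wt_def if_distrib[of "(*) _"] cong: if_cong)
  then have "Poly_Mapping.lookup (yexp i) 1 = b i" using k_pos by (simp add: yexp_def lookup_mk)
  moreover have "size_V (yexp i) = k" using assms by (simp add: size_V_def lookup_yexp)
  ultimately show ?thesis using monom_degree_M assms by simp
qed

text \<open>Interpolates between all invariant monomials of degree \<open>d\<close>, at
  \<open>J = {}\<close>, and those in the basis over the \<open>y i\<close>, at
  \<open>J = V\<close>.\<close>

definition "reduced J d = {m \<in> M. (\<forall>i\<in>J. Poly_Mapping.lookup m i < k) \<and> monom_degree m = d}"

lemma finite_reduced: "finite (reduced J d)"
  by (rule finite_subset[OF _ finite_M_degree[of d]]) (auto simp: reduced_def)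

definition "gf J = (Abs_fps (\<lambda>d. of_nat (card (reduced J d))) :: rat fps)"

lemma hilbert_series_A: "hilbert_series A = gf {}"
proof -
  have "vector_space.dim scale_poly (homogeneous_part A d) = card (reduced {} d)" for d
    unfolding A_eq using finite_reduced[of "{}" d] by (subst dim_homogeneous_part) (auto simp: reduced_def)
  then show ?thesis by (simp add: hilbert_series_def gf_def)
qed

text \<open>An exponent at \<open>i\<close> is below \<open>k\<close> or a factor
  \<open>yexp i\<close> can be split off. That factor has exponent zero at every index in
  \<open>J\<close>, so the conditions there are unaffected.\<close>

lemma reduced_split:
  assumes i: "i \<in> V" "i \<notin> J" and J: "J \<subseteq> V"
  shows "reduced J d = reduced (insert i J) d \<union>
    (if k + b i \<le> d then (\<lambda>m. yexp i + m) ` reduced J (d - (k + b i)) else {})"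
proof (intro equalityI subsetI)
  fix m assume m: "m \<in> reduced J d"
  show "m \<in> reduced (insert i J) d \<union>
    (if k + b i \<le> d then (\<lambda>m. yexp i + m) ` reduced J (d - (k + b i)) else {})"
  proof (cases "Poly_Mapping.lookup m i < k")
    case True
    then show ?thesis using m by (simp add: reduced_def)
  next
    case False
    then have ge: "k \<le> Poly_Mapping.lookup m i" by simp
    have mM: "m \<in> M" using m by (simp add: reduced_def)
    obtain m' where m': "m' \<in> M" "m = yexp i + m'"
        "\<And>j. j \<in> V \<Longrightarrow> Poly_Mapping.lookup m j = (if j = i then k else 0) + Poly_Mapping.lookup m' j"
      by (rule split_yexp[OF mM i(1) ge]) (blast intro: that)
    have "d = k + b i + monom_degree m'"
      using m m'(2) monom_degree_yexp[OF i(1)] by (simp add: reduced_def monom_degree_add)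
    moreover have "\<forall>j\<in>J. Poly_Mapping.lookup m' j < k"
    proof
      fix j assume j: "j \<in> J"
      then have "Poly_Mapping.lookup m j = Poly_Mapping.lookup m' j" using m'(3)[of j] i J by auto
      then show "Poly_Mapping.lookup m' j < k" using m j by (auto simp: reduced_def)
    qed
    ultimately show ?thesis using m' by (simp add: reduced_def)
  qed
next
  fix m
  assume "m \<in> reduced (insert i J) d \<union>
    (if k + b i \<le> d then (\<lambda>m. yexp i + m) ` reduced J (d - (k + b i)) else {})"
  then consider "m \<in> reduced (insert i J) d"
    | m' where "k + b i \<le> d" "m = yexp i + m'" "m' \<in> reduced J (d - (k + b i))"
    by (auto split: if_splits)
  then show "m \<in> reduced J d"
  proof cases
    case 2
    have "Poly_Mapping.lookup m j < k" if "j \<in> J" for j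
      using 2 that i J lookup_yexp[OF i(1), of j] by (auto simp: reduced_def lookup_add subset_eq)
    then show ?thesis
      using 2 i by (auto simp: reduced_def add_in_M monom_degree_add monom_degree_yexp)
  qed (simp add: reduced_def)
qed

text \<open>Counting the two disjoint pieces of \<open>reduced_split\<close>; the shifted piece
  contributes \<open>fps_X ^ (k + b i) * gf J\<close>.\<close>

lemma gf_insert:
  assumes i: "i \<in> V" "i \<notin> J" and J: "J \<subseteq> V"
  shows "gf (insert i J) = (1 - fps_X ^ (k + b i)) * gf J"
proof (rule fps_ext)
  fix d
  have disj: "reduced (insert i J) d \<inter> (\<lambda>m. yexp i + m) ` X = {}" for X
    using lookup_yexp[OF i(1) i(1)] by (auto simp: reduced_def lookup_add)
  have "card (reduced J d) = card (reduced (insert i J) d) +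
      (if k + b i \<le> d then card (reduced J (d - (k + b i))) else 0)"
  proof (cases "k + b i \<le> d")
    case True
    have "card ((\<lambda>m. yexp i + m) ` reduced J (d - (k + b i))) = card (reduced J (d - (k + b i)))"
      by (rule card_image) (auto intro: inj_onI)
    then show ?thesis
      using True disj by (subst reduced_split[OF assms]) (simp add: card_Un_disjoint finite_reduced)
  next
    case False
    then show ?thesis by (subst reduced_split[OF assms]) simp
  qed
  then show "fps_nth (gf (insert i J)) d = fps_nth ((1 - fps_X ^ (k + b i)) * gf J) d"
    by (simp add: gf_def left_diff_distrib fps_X_power_mult_nth)
qed

lemma gf_eq:
  assumes "J \<subseteq> V"
  shows "gf J = (\<Prod>i\<in>J. 1 - fps_X ^ (k + b i)) * gf {}"
proof -
  have "finite J" using assms finite_V finite_subset by blast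
  then show ?thesis using assms
    by (induction J) (simp_all add: gf_insert mult.assoc)
qed

end

context gorenstein_weights
begin

theorem a_invariant_A:
  "has_a_invariant A ((\<Sum>j = 1..n. a j) div a 1 - int n)"
proof -
  define E where "E = {m \<in> M. \<forall>i\<in>V. Poly_Mapping.lookup m i < k}"
  \<comment> \<open>The fraction \<open>p / q\<close> need not be in lowest terms, and
    \<open>has_rational_degree\<close> admits any representation.\<close>
  define p where "p = (\<Sum>m\<in>E. Polynomial.monom (1 :: rat) (monom_degree m))"
  define q where "q = (\<Prod>i\<in>V. 1 - Polynomial.monom (1 :: rat) (k + b i))"
  have E: "finite E" unfolding E_def by (rule finite_residues)
  have coeff_p: "Polynomial.coeff p d = of_nat (card (reduced V d))" for d
  proof -
    have "Polynomial.coeff p d = (\<Sum>m\<in>E. if monom_degree m = d then 1 else 0)"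
      by (simp add: p_def coeff_sum)
    also have "\<dots> = of_nat (card {m \<in> E. monom_degree m = d})"
      using E by (simp add: sum.If_cases Int_def)
    also have "{m \<in> E. monom_degree m = d} = reduced V d" by (auto simp: E_def reduced_def)
    finally show ?thesis .
  qed
  have "fps_of_poly q * gf {} = gf V"
    by (simp add: q_def gf_eq[of V] fps_of_poly_prod fps_of_poly_diff fps_of_poly_monom')
  also have "\<dots> = fps_of_poly p"
    by (rule fps_ext) (simp add: gf_def coeff_p)
  finally have series: "fps_of_poly q * hilbert_series A = fps_of_poly p"
    by (simp add: hilbert_series_A)

  have top_E: "top_exp \<in> E"
    using top_in_M k_pos by (simp add: E_def top_exp_def lookup_mk)
  \<comment> \<open>On \<open>V\<close> the top monomial dominates every exponent vector of
    \<open>E\<close>. The weight is monotone, so it dominates in the first variable as well.\<close>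
  have max: "monom_degree m \<le> monom_degree top_exp" if m: "m \<in> E" for m
  proof -
    have le: "Poly_Mapping.lookup m i \<le> Poly_Mapping.lookup top_exp i" if "i \<in> V" for i
      using m that by (fastforce simp: E_def top_exp_def lookup_mk)
    have mM: "m \<in> M" using m by (simp add: E_def)
    have "wt (Poly_Mapping.lookup m) \<le> wt (Poly_Mapping.lookup top_exp)"
      unfolding wt_def using le by (intro sum_mono mult_left_mono) auto
    then have "k * Poly_Mapping.lookup m 1 \<le> k * Poly_Mapping.lookup top_exp 1"
      using mM top_in_M by (simp add: M_def)
    then have "Poly_Mapping.lookup m 1 \<le> Poly_Mapping.lookup top_exp 1" using k_pos by simp
    moreover have "size_V m \<le> size_V top_exp"
      unfolding size_V_def using le by (rule sum_mono)
    ultimately show ?thesis using monom_degree_M mM top_in_M by simp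
  qed
  have "card (reduced V (monom_degree top_exp)) \<noteq> 0"
    using top_E finite_reduced by (auto simp: E_def reduced_def)
  then have lead: "Polynomial.coeff p (monom_degree top_exp) \<noteq> 0" by (simp add: coeff_p)
  then have p: "p \<noteq> 0" by auto
  have deg_p: "Polynomial.degree p = monom_degree top_exp"
  proof (rule antisym)
    show "Polynomial.degree p \<le> monom_degree top_exp"
      unfolding p_def using max by (intro degree_sum_le E) (auto simp: degree_monom_eq)
    show "monom_degree top_exp \<le> Polynomial.degree p" using lead by (rule le_degree)
  qed
  have deg_factor: "Polynomial.degree (1 - Polynomial.monom (1 :: rat) (k + b i)) = k + b i" for i
  proof -
    have "Polynomial.degree (1 + - Polynomial.monom (1 :: rat) (k + b i)) =
        Polynomial.degree (- Polynomial.monom (1 :: rat) (k + b i))"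
      using k_pos by (intro degree_add_eq_right) (simp add: degree_monom_eq)
    then show ?thesis by (simp add: degree_monom_eq)
  qed
  then have factor: "1 - Polynomial.monom (1 :: rat) (k + b i) \<noteq> 0" for i
    using k_pos by (metis add_is_0 degree_0 not_less_zero)
  then have q: "q \<noteq> 0" by (simp add: q_def)
  have deg_q: "Polynomial.degree q = (\<Sum>i\<in>V. k + b i)"
    unfolding q_def using factor by (subst degree_prod_eq_sum_degree) (auto simp: deg_factor)

  \<comment> \<open>With \<open>sum b V = k * s\<close>, the numerator has degree
    \<open>(k - 1) * s + (n - 1) * (k - 1)\<close> and the denominator
    \<open>(n - 1) * k + k * s\<close>; the difference is \<open>1 - s - n\<close>. The sum of all
    weights is \<open>a 1 * (1 - s)\<close>, so its division by \<open>a 1\<close> is exact.\<close>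
  obtain s where s: "sum b V = k * s" using k_dvd by blast
  have card_V: "card V = n - 1" by (simp add: V_def)
  have "wt (\<lambda>_. k - 1) = k * ((k - 1) * s)"
    by (simp add: wt_def s sum_distrib_right[symmetric])
  then have "Poly_Mapping.lookup top_exp 1 = (k - 1) * s"
    using k_pos by (simp add: top_exp_def lookup_mk)
  moreover have "size_V top_exp = (n - 1) * (k - 1)"
    by (simp add: size_V_def top_exp_def lookup_mk card_V)
  ultimately have dp: "Polynomial.degree p = (k - 1) * s + (n - 1) * (k - 1)"
    using deg_p monom_degree_M[OF top_in_M] by simp
  have dq: "Polynomial.degree q = (n - 1) * k + k * s"
    using deg_q by (simp add: sum.distrib s card_V)
  have k: "a 1 = - int k" using a1_neg by (simp add: k_def)
  have "(\<Sum>j = 1..n. a j) = a 1 + (\<Sum>j\<in>V. a j)"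
    using n_pos by (simp add: V_def sum.atLeast_Suc_atMost numeral_2_eq_2)
  also have "(\<Sum>j\<in>V. a j) = int (sum b V)"
    unfolding of_nat_sum V_def using a_pos by (intro sum.cong refl) (auto simp: b_def order_less_imp_le)
  finally have "(\<Sum>j = 1..n. a j) = a 1 * (1 - int s)" using k by (simp add: s algebra_simps)
  then have "(\<Sum>j = 1..n. a j) div a 1 - int n = 1 - int s - int n"
    using a1_neg by simp
  also have "\<dots> = int (Polynomial.degree p) - int (Polynomial.degree q)"
  proof -
    have "int (k - 1) = int k - 1" "int (n - 1) = int n - 1"
      using k_pos n_pos by simp_all
    then show ?thesis
      unfolding dp dq of_nat_add of_nat_mult by (simp add: algebra_simps)
  qed
  finally show ?thesis
    unfolding has_a_invariant_def has_rational_degree_def using p q series by blast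
qed

end

theorem corollary7p7:
  fixes n :: nat and a :: "nat \<Rightarrow> int"
  assumes "n \<ge> 1"
    and "a 1 < 0"
    and "\<And>i. i \<in> {2..n} \<Longrightarrow> a i > 0"
    and "a 1 dvd (\<Sum>j = 2..n. a j)"
  shows "gorenstein_ring (invariant_ring n a) \<and>
    has_a_invariant (invariant_polys n a) ((\<Sum>j = 1..n. a j) div a 1 - int n)"
proof -
  interpret gorenstein_weights n a
    using assms by unfold_locales
  show ?thesis
    using gorenstein_A a_invariant_A by (simp add: invariant_ring_def ring_on_def)
qed

end
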